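(* The manifold-constrained magnetic integrator $\hat\Phi(\cdot;\epsilon,N):\mathrm{T}^*M\to\mathrm{T}^*M$ (defined in the context) is symplectic and symmetric. That is: (Symplectic) for fixed step size $\epsilon$ and number of steps $N\in\mathbb{N}$, $\hat\Phi(\cdot;\epsilon,N)^*\,\Omega_{\mathrm{mag}}=\Omega_{\mathrm{mag}}$ on $\mathrm{T}^*M$; (Symmetric) for fixed $N$, $\hat\Phi(\hat\Phi(z;-\epsilon,N);\epsilon,N)=z$ for all $z\in\mathrm{T}^*M$ and all step sizes $\epsilon$.
   Context: Let $g:\mathbb{R}^m\to\mathbb{R}^k$ be a smooth constraint function with Jacobian $G(q)\in\mathbb{R}^{k\times m}$, and let $M=\{q\in\mathbb{R}^m:g(q)=0\}$, where $G(q)$ is assumed to have full rank for every $q\in M$. Let $U:\mathbb{R}^m\to\mathbb{R}$ be smooth, let the Hamiltonian be $H(q,p)=U(q)+\frac12p^\top p$, and let $\mathrm{L}\in\mathbb{R}^{m\times m}$ be skew-symmetric. The cotangent bundle is embedded as $\mathrm{T}^*M=\{(q,p)\in\mathbb{R}^{2m}:g(q)=0,\ G(q)p=0\}$. The magnetic symplectic structure is $\Omega_{\mathrm{mag}}(u,v)=u^\top\mathbb{J}_{\mathrm{mag}}v$ with $\mathbb{J}_{\mathrm{mag}}=\begin{pmatrix}\mathrm{L}&\mathrm{Id}_m\\-\mathrm{Id}_m&\mathbf{0}_m\end{pmatrix}$, for tangent vectors $u,v\in\mathrm{T}_{(q,p)}\mathrm{T}^*M$. The pullback by $\Phi:\mathrm{T}^*M\to\mathrm{T}^*M$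 is $(\Phi^*\Omega)(u,v)=\Omega((\mathrm{T}_z\Phi)u,(\mathrm{T}_z\Phi)v)$, where $\mathrm{T}_z\Phi$ is the derivative of $\Phi$ at $z$. Let $\Phi_1^\epsilon,\Phi_2^\epsilon:\mathbb{R}^{2m}\to\mathbb{R}^{2m}$ be the time-$\epsilon$ flows, for the unconstrained magnetic equations $\dot q=\nabla_pH_i$, $\dot p=-\nabla_qH_i-\mathrm{L}\nabla_pH_i$, of $H_1(q,p)=U(q)/2$ and $H_2(q,p)=p^\top p/2$ respectively: $$\Phi_1^\epsilon(q,p)=\big(q,\ p-\tfrac{\epsilon}{2}\nabla U(q)\big),\qquad \Phi_2^\epsilon(q,p)=\Big(q+\int_0^\epsilon e^{-s\mathrm{L}}p\,ds,\ e^{-\epsilon\mathrm{L}}p\Big).$$ One step of the manifold-constrained magnetic integrator with step size $\epsilon$ maps $(q_n,p_n)\in\mathrm{T}^*M$ to $(q_{n+1},p_{n+1})\in\mathrm{T}^*M$ by $$\bar p_{n+1/2}=p_n-\tfrac{\epsilon}{2}G(q_n)^\top\mu,\qquad (q_{n+1},\bar p_{n+1})=\Phi_1^\epsilon\circ\Phi_2^\epsilon\circ\Phi_1^\epsilon(q_n,\bar p_{n+1/2}),\qquad p_{n+1}=\bar p_{n+1}-\tfrac{\epsilon}{2}G(q_{n+1})^\top\mu',$$ where the Lagrange multipliers $\mu,\mu'\in\mathbb{R}^k$ are chosen such that $g(q_{n+1})=0$ and $G(q_{n+1})p_{n+1}=0$. Such Lagrange multipliers exist and are unique provided $\epsilon\neq0$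 is small enough, and this is understood throughout. The map $\hat\Phi(\cdot;\epsilon,N)$ sends $(q_0,p_0)$ to $(q_N,p_N)$, the result of $N$ such steps.
   Formalization: Multipliers are sought in an open set B; the claims hold at those z in T*M along whose orbit they exist uniquely nearby and are nondegenerate for both ε and −ε. This is proved for each compact subset of T*M, every large ball B and all small ε≠0, not for one ε on all of T*M. *)

theory Defs
  imports "HOL-Analysis.Analysis"
begin

fun times_diff :: "nat \<Rightarrow> ('a::euclidean_space \<Rightarrow> 'b::euclidean_space) \<Rightarrow> bool" where
  "times_diff 0 f \<longleftrightarrow> continuous_on UNIV f"
| "times_diff (Suc n) f \<longleftrightarrow>
     (\<forall>x. f differentiable (at x)) \<and>
     (\<forall>v. times_diff n (\<lambda>x. frechet_derivative f (at x) v))"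

definition smooth_map :: "('a::euclidean_space \<Rightarrow> 'b::euclidean_space) \<Rightarrow> bool" where
  "smooth_map f \<longleftrightarrow> (\<forall>n. times_diff n f)"

definition grad :: "(real^'m \<Rightarrow> real) \<Rightarrow> real^'m \<Rightarrow> real^'m" where
  "grad U q = (\<chi> i. frechet_derivative U (at q) (axis i 1))"

(* The type real^'n^'n carries no Banach algebra structure with respect to **, so the
   library function exp is not available for matrices. *)
definition mat_exp :: "real^'n^'n \<Rightarrow> real^'n^'n" where
  "mat_exp A = (\<Sum>n. (1 / fact n) *\<^sub>R ((\<lambda>X. A ** X) ^^ n) (mat 1))"

abbreviation Jac :: "(real^'m \<Rightarrow> real^'k) \<Rightarrow> real^'m \<Rightarrow> real^'m^'k" where
  "Jac g q \<equiv> jacobian g (at q)"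

definition cotangent_bundle :: "(real^'m \<Rightarrow> real^'k) \<Rightarrow> ((real^'m) \<times> (real^'m)) set" where
  "cotangent_bundle g = {(q, p). g q = 0 \<and> Jac g q *v p = 0}"

(* Tangent space of an embedded submanifold S at z: velocities of curves in S through z. *)
definition tangent_space :: "'a::real_normed_vector set \<Rightarrow> 'a \<Rightarrow> 'a set" where
  "tangent_space S z =
     {v. \<exists>\<gamma>. \<gamma> 0 = z \<and> (\<forall>\<^sub>F t in nhds 0. \<gamma> t \<in> S) \<and> (\<gamma> has_vector_derivative v) (at (0::real))}"

definition J_mag :: "real^'m^'m \<Rightarrow> (real^'m) \<times> (real^'m) \<Rightarrow> (real^'m) \<times> (real^'m)" where
  "J_mag L v = (L *v fst v + snd v, - fst v)"

definition Omega_mag ::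
  "real^'m^'m \<Rightarrow> (real^'m) \<times> (real^'m) \<Rightarrow> (real^'m) \<times> (real^'m) \<Rightarrow> real" where
  "Omega_mag L u v = u \<bullet> J_mag L v"

(* The derivative of \<Phi> : S \<rightarrow> S at z is a derivative within S. On tangent_space S z its value does
   not depend on which derivative within S frechet_derivative selects. *)
definition pullback_on ::
  "'a::real_normed_vector set \<Rightarrow> ('a \<Rightarrow> 'a) \<Rightarrow> ('a \<Rightarrow> 'a \<Rightarrow> real) \<Rightarrow> 'a \<Rightarrow> 'a \<Rightarrow> 'a \<Rightarrow> real" where
  "pullback_on S \<Phi> \<Omega> z u v =
     \<Omega> (frechet_derivative \<Phi> (at z within S) u) (frechet_derivative \<Phi> (at z within S) v)"

definition flow1 ::
  "(real^'m \<Rightarrow> real) \<Rightarrow> real \<Rightarrow> (real^'m) \<times> (real^'m) \<Rightarrow> (real^'m) \<times> (real^'m)" where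
  "flow1 U \<epsilon> = (\<lambda>(q, p). (q, p - (\<epsilon> / 2) *\<^sub>R grad U q))"

(* The interval integral is oriented, as negative \<epsilon> requires. *)
definition flow2 ::
  "real^'m^'m \<Rightarrow> real \<Rightarrow> (real^'m) \<times> (real^'m) \<Rightarrow> (real^'m) \<times> (real^'m)" where
  "flow2 L \<epsilon> = (\<lambda>(q, p).
     (q + (LBINT s=ereal 0..ereal \<epsilon>. mat_exp ((- s) *\<^sub>R L) *v p),
      mat_exp ((- \<epsilon>) *\<^sub>R L) *v p))"

definition constraint_kick ::
  "(real^'m \<Rightarrow> real^'k) \<Rightarrow> real \<Rightarrow> real^'k \<Rightarrow> (real^'m) \<times> (real^'m) \<Rightarrow> (real^'m) \<times> (real^'m)" where
  "constraint_kick g \<epsilon> \<mu> = (\<lambda>(q, p). (q, p - (\<epsilon> / 2) *\<^sub>R (transpose (Jac g q) *v \<mu>)))"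

definition step_with ::
  "(real^'m \<Rightarrow> real^'k) \<Rightarrow> (real^'m \<Rightarrow> real) \<Rightarrow> real^'m^'m \<Rightarrow> real \<Rightarrow>
   (real^'k) \<times> (real^'k) \<Rightarrow> (real^'m) \<times> (real^'m) \<Rightarrow> (real^'m) \<times> (real^'m)" where
  "step_with g U L \<epsilon> = (\<lambda>(\<mu>, \<mu>').
     constraint_kick g \<epsilon> \<mu>' \<circ> (flow1 U \<epsilon> \<circ> flow2 L \<epsilon> \<circ> flow1 U \<epsilon>) \<circ> constraint_kick g \<epsilon> \<mu>)"

(* B is the set in which both multipliers are sought. With B = UNIV, uniqueness is global.
   This fails for most constraints even for tiny \<epsilon>: on a sphere the line of candidate positions
   q_{n+1} meets M a second time, with \<mu> of order 1/\<epsilon>^2. The uniqueness valid for all small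
   \<epsilon> is uniqueness in a bounded B. *)
definition is_multiplier ::
  "(real^'m \<Rightarrow> real^'k) \<Rightarrow> (real^'m \<Rightarrow> real) \<Rightarrow> real^'m^'m \<Rightarrow> (real^'k) set \<Rightarrow> real \<Rightarrow>
   (real^'m) \<times> (real^'m) \<Rightarrow> (real^'k) \<times> (real^'k) \<Rightarrow> bool" where
  "is_multiplier g U L B \<epsilon> z m \<longleftrightarrow> m \<in> B \<times> B \<and> step_with g U L \<epsilon> m z \<in> cotangent_bundle g"

definition multipliers ::
  "(real^'m \<Rightarrow> real^'k) \<Rightarrow> (real^'m \<Rightarrow> real) \<Rightarrow> real^'m^'m \<Rightarrow> (real^'k) set \<Rightarrow> real \<Rightarrow>
   (real^'m) \<times> (real^'m) \<Rightarrow> (real^'k) \<times> (real^'k)" where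
  "multipliers g U L B \<epsilon> z = (THE m. is_multiplier g U L B \<epsilon> z m)"

definition one_step ::
  "(real^'m \<Rightarrow> real^'k) \<Rightarrow> (real^'m \<Rightarrow> real) \<Rightarrow> real^'m^'m \<Rightarrow> (real^'k) set \<Rightarrow> real \<Rightarrow>
   (real^'m) \<times> (real^'m) \<Rightarrow> (real^'m) \<times> (real^'m)" where
  "one_step g U L B \<epsilon> z = step_with g U L \<epsilon> (multipliers g U L B \<epsilon> z) z"

definition integrator ::
  "(real^'m \<Rightarrow> real^'k) \<Rightarrow> (real^'m \<Rightarrow> real) \<Rightarrow> real^'m^'m \<Rightarrow> (real^'k) set \<Rightarrow> real \<Rightarrow> nat \<Rightarrow>
   (real^'m) \<times> (real^'m) \<Rightarrow> (real^'m) \<times> (real^'m)" where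
  "integrator g U L B \<epsilon> N = one_step g U L B \<epsilon> ^^ N"

(* Nondegeneracy of the equation g q_{n+1} = 0 in \<mu>, as in the implicit function theorem;
   q_{n+1} does not depend on \<mu>'. *)
definition regular_multiplier ::
  "(real^'m \<Rightarrow> real^'k) \<Rightarrow> (real^'m \<Rightarrow> real) \<Rightarrow> real^'m^'m \<Rightarrow> real \<Rightarrow>
   (real^'m) \<times> (real^'m) \<Rightarrow> (real^'k) \<times> (real^'k) \<Rightarrow> bool" where
  "regular_multiplier g U L \<epsilon> z m \<longleftrightarrow>
     invertible (jacobian (\<lambda>\<mu>. g (fst (step_with g U L \<epsilon> (\<mu>, snd m) z))) (at (fst m)))"

(* "The step size is small enough at z", for \<epsilon> as well as for -\<epsilon>: near z the multipliers exist
   and are unique, and at z they are nondegenerate. Existence and uniqueness alone do not suffice: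
   at a degenerate solution the step can fail to be differentiable. For \<epsilon> = 0 and open B the
   condition fails. *)
definition small_enough_at ::
  "(real^'m \<Rightarrow> real^'k) \<Rightarrow> (real^'m \<Rightarrow> real) \<Rightarrow> real^'m^'m \<Rightarrow> (real^'k) set \<Rightarrow> real \<Rightarrow>
   (real^'m) \<times> (real^'m) \<Rightarrow> bool" where
  "small_enough_at g U L B \<epsilon> z \<longleftrightarrow>
     (\<forall>e\<in>{\<epsilon>, - \<epsilon>}.
        (\<forall>\<^sub>F w in nhds z. w \<in> cotangent_bundle g \<longrightarrow> (\<exists>!m. is_multiplier g U L B e w m)) \<and>
        regular_multiplier g U L e z (multipliers g U L B e z))"

(* In general no single \<epsilon> is small enough on all of T^*M, as p is unbounded. This is the set of
   initial values for which \<epsilon> is small enough at z_0, ..., z_N. *)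
definition integrator_domain ::
  "(real^'m \<Rightarrow> real^'k) \<Rightarrow> (real^'m \<Rightarrow> real) \<Rightarrow> real^'m^'m \<Rightarrow> (real^'k) set \<Rightarrow> real \<Rightarrow> nat \<Rightarrow>
   ((real^'m) \<times> (real^'m)) set" where
  "integrator_domain g U L B \<epsilon> N =
     {z \<in> cotangent_bundle g. \<forall>n\<le>N. small_enough_at g U L B \<epsilon> (integrator g U L B \<epsilon> n z)}"

end

theory Submission
  imports Defs
begin

text \<open>
  Symplecticity. Both flows preserve \<^const>\<open>Omega_mag\<close>, because Hessians are symmetric and because
  \<open>R = e\<^bsup>-\<epsilon>L\<^esup>\<close> and its integral \<open>A\<close> satisfy \<open>L A + R = 1\<close> and \<open>A\<^sup>T = R\<^sup>T A\<close>. A constraint kick changes the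
  form by terms that cancel on vectors with \<open>G(q) \<delta>q = 0\<close>, and such are the position parts of tangent
  vectors before and after the step. The implicit function theorem, applied to both multipliers at
  once, makes the step differentiable along the manifold.

  Symmetry. The step of size \<open>\<epsilon>\<close> with multipliers \<open>(\<mu>', \<mu>)\<close> inverts the step of size \<open>-\<epsilon>\<close> with
  multipliers \<open>(\<mu>, \<mu>')\<close>; uniqueness shows that the integrator selects these.

  Small steps. As a function of \<open>\<mu>\<close>, the negative of \<open>g(q\<^sub>n\<^sub>+\<^sub>1)\<close> is strongly monotone with a constant of
  order \<open>\<epsilon>\<^sup>2\<close>, uniformly for \<open>\<mu>\<close> in any fixed ball, and at \<open>\<mu> = 0\<close> it is of size \<open>O(\<epsilon>\<^sup>2)\<close>. Hence it has exactly
  one zero in a ball whose radius does not depend on \<open>\<epsilon>\<close>; existence is Brouwer's theorem.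
\<close>

subsection \<open>Continuously differentiable maps\<close>

text \<open>Origin of the orders in the small-step argument: the first kick brings
  \<open>\<mu>\<close> into the momentum with a factor t/2, and the drift moves the position by a
  further factor t. So the derivative of g(q_{n+1}) in \<open>\<mu>\<close> is -(t^2/2) G(q_{n+1})
  (A/t) G(q_n)^T. As t tends to 0, A/t tends to the identity and the matrix to G G^T, which is
  positive definite by full rank. The residual at \<open>\<mu> = 0\<close> is O(t^2) instead of O(t)
  because its first-order term is G(q) p, zero on the cotangent bundle. The two factors t^2 cancel.
  For the second multiplier a factor 2/t meets a velocity defect of order t. The obstacle in the
  symplectic part: the step is given by a differentiable formula only near a point and only on the
  cotangent bundle. Derivatives are therefore taken within that set, where they need not be unique
  as linear maps, and they are compared through velocities of curves. Moreover the multipliers vary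
  with the initial value, so their derivatives enter the derivative of each kick.\<close>

definition C1 :: "('a::euclidean_space \<Rightarrow> 'b::euclidean_space) \<Rightarrow> bool" where
  "C1 f \<longleftrightarrow> (\<exists>f'. (\<forall>x. (f has_derivative blinfun_apply (f' x)) (at x)) \<and> continuous_on UNIV f')"

text \<open>In finite dimension, continuity of the derivative in each fixed direction is already
  continuity in operator norm. So \<open>C1\<close>, whose form suits the inverse function theorem,
  can be checked one direction at a time.\<close>

lemma C1I:
  fixes f :: "'a::euclidean_space \<Rightarrow> 'b::euclidean_space"
  assumes D: "\<And>x. (f has_derivative D x) (at x)"
    and c: "\<And>v. continuous_on UNIV (\<lambda>x. D x v)"
  shows "C1 f"
proof -
  have *: "blinfun_apply (Blinfun (D x)) = D x" for x
    using D has_derivative_bounded_linear bounded_linear_Blinfun_apply by blast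
  have "continuous_on UNIV (\<lambda>x. Blinfun (D x))"
    by (rule continuous_on_blinfun_componentwise) (simp add: * c)
  then show ?thesis
    unfolding C1_def using D * by metis
qed

lemma continuous_on_apply2:
  assumes "continuous_on UNIV (\<lambda>p. D (fst p) (snd p))" "continuous_on S a" "continuous_on S b"
  shows "continuous_on S (\<lambda>y. D (a y) (b y))"
  using continuous_on_compose2[OF assms(1) continuous_on_Pair[OF assms(2,3)]] by simp

text \<open>Continuity holds jointly in base point and direction. The chain rule needs this form,
  because there the direction \<open>Dg x v\<close> moves with \<open>x\<close>.\<close>

lemma C1_derivE:
  assumes "C1 f"
  obtains D where "\<And>x. (f has_derivative D x) (at x)"
    and "continuous_on UNIV (\<lambda>p. D (fst p) (snd p))"
proof -
  obtain f' where f': "\<And>x. (f has_derivative blinfun_apply (f' x)) (at x)" "continuous_on UNIV f'"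
    using assms unfolding C1_def by blast
  have "continuous_on UNIV (\<lambda>p. blinfun_apply (f' (fst p)) (snd p))"
    by (intro continuous_intros continuous_on_compose2[OF f'(2)]) auto
  with f'(1) show thesis
    by (rule that)
qed

lemma C1_continuous_on: "C1 f \<Longrightarrow> continuous_on S f"
  unfolding C1_def
  by (meson continuous_at_imp_continuous_on has_derivative_continuous)

lemma C1_differentiable: "C1 f \<Longrightarrow> f differentiable (at x)"
  unfolding C1_def differentiable_def by blast

lemma C1_bounded_linear: "bounded_linear f \<Longrightarrow> C1 f"
  by (rule C1I[where D = "\<lambda>_. f"]) (auto intro: bounded_linear_imp_has_derivative)

lemma C1_const [intro]: "C1 (\<lambda>x. c)"
  by (rule C1I[where D = "\<lambda>_ _. 0"]) auto

lemma C1_compose: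
  assumes "C1 f" "C1 g" shows "C1 (\<lambda>x. f (g x))"
proof -
  obtain Df where Df: "\<And>x. (f has_derivative Df x) (at x)"
    "continuous_on UNIV (\<lambda>p. Df (fst p) (snd p))"
    using C1_derivE[OF assms(1)] by blast
  obtain Dg where Dg: "\<And>x. (g has_derivative Dg x) (at x)"
    "continuous_on UNIV (\<lambda>p. Dg (fst p) (snd p))"
    using C1_derivE[OF assms(2)] by blast
  show ?thesis
  proof (rule C1I)
    show "((\<lambda>x. f (g x)) has_derivative (\<lambda>v. Df (g x) (Dg x v))) (at x)" for x
      by (rule has_derivative_compose[OF Dg(1) Df(1)])
    show "continuous_on UNIV (\<lambda>x. Df (g x) (Dg x v))" for v
      by (intro continuous_on_apply2[OF Df(2)] continuous_on_apply2[OF Dg(2)] C1_continuous_on assms continuous_intros)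
  qed
qed

lemma C1_bilinear:
  assumes h: "bounded_bilinear h" and "C1 f" "C1 g"
  shows "C1 (\<lambda>x. h (f x) (g x))"
proof -
  obtain Df where Df: "\<And>x. (f has_derivative Df x) (at x)"
    "continuous_on UNIV (\<lambda>p. Df (fst p) (snd p))"
    using C1_derivE[OF assms(2)] by blast
  obtain Dg where Dg: "\<And>x. (g has_derivative Dg x) (at x)"
    "continuous_on UNIV (\<lambda>p. Dg (fst p) (snd p))"
    using C1_derivE[OF assms(3)] by blast
  show ?thesis
  proof (rule C1I)
    show "((\<lambda>x. h (f x) (g x)) has_derivative (\<lambda>v. h (f x) (Dg x v) + h (Df x v) (g x))) (at x)" for x
      using bounded_bilinear.FDERIV[OF h Df(1) Dg(1)] .
    show "continuous_on UNIV (\<lambda>x. h (f x) (Dg x v) + h (Df x v) (g x))" for v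
      by (intro continuous_on_add bounded_bilinear.continuous_on[OF h] continuous_on_apply2[OF Df(2)] continuous_on_apply2[OF Dg(2)]
          C1_continuous_on assms continuous_intros)
  qed
qed

lemma C1_Pair:
  assumes "C1 f" "C1 g" shows "C1 (\<lambda>x. (f x, g x))"
proof -
  obtain Df where Df: "\<And>x. (f has_derivative Df x) (at x)"
    "continuous_on UNIV (\<lambda>p. Df (fst p) (snd p))"
    using C1_derivE[OF assms(1)] by blast
  obtain Dg where Dg: "\<And>x. (g has_derivative Dg x) (at x)"
    "continuous_on UNIV (\<lambda>p. Dg (fst p) (snd p))"
    using C1_derivE[OF assms(2)] by blast
  show ?thesis
    by (rule C1I[OF has_derivative_Pair[OF Df(1) Dg(1)]])
      (intro continuous_on_apply2[OF Df(2)] continuous_on_apply2[OF Dg(2)] continuous_intros)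
qed

lemma C1_linear_compose: "bounded_linear h \<Longrightarrow> C1 f \<Longrightarrow> C1 (\<lambda>x. h (f x))"
  by (rule C1_compose[OF C1_bounded_linear])

lemma bounded_bilinear_matrix_vector: "bounded_bilinear ((*v) :: real^'n^'m \<Rightarrow> real^'n \<Rightarrow> real^'m)"
  unfolding bilinear_conv_bounded_bilinear[symmetric] bilinear_def
proof (intro conjI allI linearI)
qed (simp_all only: matrix_vector_right_distrib matrix_vector_mult_add_rdistrib
      scaleR_matrix_vector_assoc[symmetric] matrix_vector_mult_scaleR)

lemma bounded_linear_transpose: "bounded_linear (transpose :: real^'n^'m \<Rightarrow> real^'m^'n)"
  unfolding linear_conv_bounded_linear[symmetric]
  by (rule linearI) (simp_all add: transpose_def vec_eq_iff)

lemma C1_add: "C1 f \<Longrightarrow> C1 g \<Longrightarrow> C1 (\<lambda>x. f x + g x)"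
  using C1_linear_compose[OF bounded_linear_add[OF bounded_linear_fst bounded_linear_snd] C1_Pair] by simp

lemma C1_diff: "C1 f \<Longrightarrow> C1 g \<Longrightarrow> C1 (\<lambda>x. f x - g x)"
  using C1_linear_compose[OF bounded_linear_sub[OF bounded_linear_fst bounded_linear_snd] C1_Pair] by simp

lemma C1_sum: "(\<And>i. i \<in> I \<Longrightarrow> C1 (f i)) \<Longrightarrow> C1 (\<lambda>x. \<Sum>i\<in>I. f i x)"
  by (induction I rule: infinite_finite_induct) (auto intro: C1_add)

lemma C1_scaleR: "C1 f \<Longrightarrow> C1 g \<Longrightarrow> C1 (\<lambda>x. f x *\<^sub>R g x)"
  by (rule C1_bilinear[OF bounded_bilinear_scaleR])

lemma C1_matrix_vector: "C1 f \<Longrightarrow> C1 g \<Longrightarrow> C1 (\<lambda>x. f x *v g x)"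
  for f :: "_ \<Rightarrow> real^'n^'m"
  by (rule C1_bilinear[OF bounded_bilinear_matrix_vector])

lemma C1_transpose: "C1 f \<Longrightarrow> C1 (\<lambda>x. transpose (f x))"
  for f :: "_ \<Rightarrow> real^'n^'m"
  by (rule C1_linear_compose[OF bounded_linear_transpose])

lemma C1_id [intro]: "C1 (\<lambda>x. x)"
  by (rule C1_bounded_linear) (rule bounded_linear_ident)

lemma C1_fst: "C1 f \<Longrightarrow> C1 (\<lambda>x. fst (f x))"
  by (rule C1_linear_compose[OF bounded_linear_fst])

lemma C1_snd: "C1 f \<Longrightarrow> C1 (\<lambda>x. snd (f x))"
  by (rule C1_linear_compose[OF bounded_linear_snd])

lemma C1_vec_lambda:
  fixes f :: "'n::finite \<Rightarrow> 'a::euclidean_space \<Rightarrow> 'b::euclidean_space"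
  assumes "\<And>i. C1 (f i)" shows "C1 (\<lambda>x. \<chi> i. f i x)"
proof -
  have lin: "bounded_linear (\<lambda>y::'b. \<chi> j::'n. if j = i then y else 0)" for i
    by (auto intro!: linearI simp: linear_conv_bounded_linear[symmetric] vec_eq_iff)
  have "C1 (\<lambda>x. \<Sum>i\<in>UNIV. (\<chi> j. if j = i then f i x else 0))"
    by (rule C1_sum) (rule C1_linear_compose[OF lin assms])
  also have "(\<lambda>x. \<Sum>i\<in>UNIV. (\<chi> j. if j = i then f i x else 0)) = (\<lambda>x. \<chi> i. f i x)"
    by (auto simp: fun_eq_iff vec_eq_iff)
  finally show ?thesis .
qed

lemma C1_vec_nth: "C1 f \<Longrightarrow> C1 (\<lambda>x. f x $ i)"
  by (rule C1_linear_compose[OF bounded_linear_vec_nth])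

lemma times_diff_1_imp_C1:
  assumes "times_diff (Suc 0) f" shows "C1 f"
proof (rule C1I)
  show "(f has_derivative frechet_derivative f (at x)) (at x)" for x
    using assms frechet_derivative_works[of f "at x"] by simp
  show "continuous_on UNIV (\<lambda>x. frechet_derivative f (at x) v)" for v
    using assms by simp
qed

text \<open>Mean value inequality in the scalar variable; \<open>C\<close> bounds the partial
  derivative in that variable on the compact set \<open>{-1..1} \<times> K\<close>. All O(t)
  estimates that are uniform over initial values come from here.\<close>

lemma C1_imp_deviation_bound:
  fixes f :: "real \<times> 'a::euclidean_space \<Rightarrow> 'b::euclidean_space"
  assumes f: "C1 f" and K: "compact K"
  shows "\<exists>C>0. \<forall>x\<in>K. \<forall>t. \<bar>t\<bar> \<le> 1 \<longrightarrow> norm (f (t, x) - f (0, x)) \<le> C * \<bar>t\<bar>"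
proof -
  obtain D where D: "\<And>x. (f has_derivative D x) (at x)"
    "continuous_on UNIV (\<lambda>p. D (fst p) (snd p))"
    using C1_derivE[OF f] by blast
  have "continuous_on ({-1..1} \<times> K) (\<lambda>y. D y (1, 0))"
    by (intro continuous_on_apply2[OF D(2)] continuous_intros)
  then have "bounded ((\<lambda>y. D y (1, 0)) ` ({-1..1} \<times> K))"
    by (intro compact_imp_bounded compact_continuous_image compact_Times K) auto
  then obtain C where C: "C > 0" "\<And>y. y \<in> {-1..1} \<times> K \<Longrightarrow> norm (D y (1, 0)) \<le> C"
    unfolding bounded_pos by auto
  have "norm (f (t, x) - f (0, x)) \<le> C * \<bar>t\<bar>" if "x \<in> K" "\<bar>t\<bar> \<le> 1" for x t
  proof -
    have "norm (f (t, x) - f (0, x)) \<le> C * norm (t - 0)"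
    proof (rule differentiable_bound[of "{-1..1}" "\<lambda>t. f (t, x)" "\<lambda>t h. D (t, x) (h, 0)"])
      show "((\<lambda>t. f (t, x)) has_derivative (\<lambda>h. D (s, x) (h, 0))) (at s within {-1..1})" for s
        by (rule has_derivative_at_withinI, rule has_derivative_compose[OF _ D(1)])
          (auto intro!: derivative_eq_intros)
      fix s :: real assume s: "s \<in> {-1..1}"
      have lin: "linear (D (s, x))"
        using D(1) has_derivative_linear by blast
      show "onorm (\<lambda>h. D (s, x) (h, 0)) \<le> C"
      proof (rule onorm_le)
        fix h :: real
        have "D (s, x) (h, 0) = h *\<^sub>R D (s, x) (1, 0)"
          using linear_scale[OF lin, of h "(1,0)"] by simp
        then show "norm (D (s, x) (h, 0)) \<le> C * norm h"
          using C(2)[of "(s, x)"] s that by (simp add: mult.commute[of C] mult_left_mono)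
      qed
    qed (use that in auto)
    then show ?thesis by simp
  qed
  with C(1) show ?thesis by blast
qed

text \<open>The inverse function theorem is applied to \<open>H (w, y) = (w, F (w, y))\<close>. Its
  derivative at \<open>(z, m)\<close> is block triangular, hence injective because \<open>D\<close>
  is. The solution \<open>\<phi>\<close> is the second component of the local inverse on the slice
  where \<open>F\<close> vanishes.\<close>

lemma C1_implicit_function:
  fixes F :: "'a::euclidean_space \<times> 'b::euclidean_space \<Rightarrow> 'b"
  assumes F: "C1 F" and z: "F (z, m) = 0"
    and D: "((\<lambda>y. F (z, y)) has_derivative D) (at m)" and inj: "\<And>v. D v = 0 \<Longrightarrow> v = 0"
  obtains \<phi> where "\<phi> z = m" "\<phi> differentiable (at z)" "\<forall>\<^sub>F w in nhds z. F (w, \<phi> w) = 0"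
proof -
  define H where "H = (\<lambda>x. (fst x, F x))"
  have "C1 H"
    unfolding H_def by (intro C1_Pair C1_fst C1_id F)
  then obtain H' where H': "\<And>x. (H has_derivative blinfun_apply (H' x)) (at x)" "continuous_on UNIV H'"
    unfolding C1_def by blast
  obtain F' where F': "\<And>x. (F has_derivative blinfun_apply (F' x)) (at x)"
    using F unfolding C1_def by blast
  have H'_eq: "blinfun_apply (H' x) v = (fst v, F' x v)" for x v
  proof -
    have "(H has_derivative (\<lambda>v. (fst v, F' x v))) (at x)"
      unfolding H_def by (auto intro!: derivative_eq_intros F')
    from has_derivative_unique[OF this H'(1)] show ?thesis by metis
  qed
  have D_eq: "D v = F' (z, m) (0, v)" for v
  proof -
    have "((\<lambda>y. F (z, y)) has_derivative (\<lambda>v. F' (z, m) (0, v))) (at m)"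
      by (rule has_derivative_compose[OF _ F']) (auto intro!: derivative_eq_intros)
    from has_derivative_unique[OF D this] show ?thesis by metis
  qed
  have lin: "linear (blinfun_apply (H' (z, m)))"
    by (simp add: blinfun.bounded_linear_right bounded_linear.linear)
  have "inj (blinfun_apply (H' (z, m)))"
    unfolding linear_injective_0[OF lin]
  proof (intro allI impI)
    fix v assume *: "blinfun_apply (H' (z, m)) v = 0"
    obtain a b where v: "v = (a, b)" by (cases v)
    have "a = 0" "F' (z, m) (0, b) = 0"
      using * unfolding v H'_eq by (auto simp: prod_eq_iff)
    with inj[of b] D_eq v show "v = 0" by (simp add: zero_prod_def)
  qed
  then obtain K where K: "linear K" "K \<circ> blinfun_apply (H' (z, m)) = id"
    using linear_injective_left_inverse[OF lin] by blast
  then have Kap: "blinfun_apply (Blinfun K) = K"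
    by (simp add: bounded_linear_Blinfun_apply linear_conv_bounded_linear)
  have "Blinfun K o\<^sub>L H' (z, m) = id_blinfun"
    using K(2) by (intro blinfun_eqI) (auto simp: Kap fun_eq_iff)
  from inverse_function_theorem[OF open_UNIV H'(1) H'(2) UNIV_I this]
  obtain U' V h h' where h: "open V" "H (z, m) \<in> V" "(z, m) \<in> U'" "homeomorphism U' V H h"
    "\<And>y. y \<in> V \<Longrightarrow> (h has_derivative h' y) (at y)" by metis
  have Hz: "H (z, m) = (z, 0)" by (simp add: H_def z)
  define \<phi> where "\<phi> = (\<lambda>w. snd (h (w, 0)))"
  show thesis
  proof
    show "\<phi> z = m"
      using h(3,4) Hz by (metis \<phi>_def homeomorphism_apply1 snd_conv)
    have "((\<lambda>w. h (w, 0)) has_derivative (\<lambda>v. h' (z, 0) (v, 0))) (at z)"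
      by (rule has_derivative_compose[OF _ h(5)]) (use h(2) Hz in \<open>auto intro!: derivative_eq_intros\<close>)
    then show "\<phi> differentiable (at z)"
      unfolding \<phi>_def differentiable_def using has_derivative_snd by blast
    have "open ((\<lambda>w. (w, 0)) -` V)"
      by (intro open_vimage h(1) continuous_intros)
    then have "\<forall>\<^sub>F w in nhds z. (w, 0) \<in> V"
      using h(2) Hz eventually_nhds by (metis (mono_tags, lifting) vimageD vimageI2)
    then show "\<forall>\<^sub>F w in nhds z. F (w, \<phi> w) = 0"
    proof eventually_elim
      case (elim w)
      then have "H (h (w, 0)) = (w, 0)"
        using h(4) by (simp add: homeomorphism_apply2)
      then show ?case
        unfolding H_def \<phi>_def by (metis fst_conv prod.collapse snd_conv)
    qed
  qed
qed

subsection \<open>Symmetry of second derivatives\<close>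

lemma has_derivative_along_line:
  fixes f :: "'a::real_normed_vector \<Rightarrow> real"
  assumes "(f has_derivative D) (at (a + s *\<^sub>R u))"
  shows "((\<lambda>s. f (a + s *\<^sub>R u)) has_real_derivative D u) (at s)"
proof -
  have "((\<lambda>s. f (a + s *\<^sub>R u)) has_derivative (\<lambda>h. D (h *\<^sub>R u))) (at s)"
    by (rule has_derivative_compose[where f = "\<lambda>s. a + s *\<^sub>R u" and g = f, OF _ assms]) (auto intro!: derivative_eq_intros)
  moreover have "(\<lambda>h. D (h *\<^sub>R u)) = (*) (D u)"
    using linear_scale[OF has_derivative_linear[OF assms]] by (auto simp: fun_eq_iff)
  ultimately show ?thesis
    by (simp add: has_field_derivative_def)
qed

text \<open>The mean value theorem is used twice: in direction \<open>u\<close> for the increment of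
  \<open>f\<close> under a shift by \<open>h *\<^sub>R v\<close>, then in direction \<open>v\<close>
  for \<open>Df _ u\<close>.\<close>

lemma second_difference_mean_value:
  fixes f :: "'a::real_normed_vector \<Rightarrow> real"
  assumes f: "\<And>y. (f has_derivative Df y) (at y)"
    and Du: "\<And>y. ((\<lambda>y. Df y u) has_derivative Du y) (at y)" and "0 < h"
  obtains s t where "0 < s" "s < h" "0 < t" "t < h"
    "f (x + h *\<^sub>R u + h *\<^sub>R v) - f (x + h *\<^sub>R u) - f (x + h *\<^sub>R v) + f x
       = h * h * Du (x + s *\<^sub>R u + t *\<^sub>R v) v"
proof -
  have "((\<lambda>s. f ((x + h *\<^sub>R v) + s *\<^sub>R u) - f (x + s *\<^sub>R u)) has_real_derivative
      Df ((x + h *\<^sub>R v) + s *\<^sub>R u) u - Df (x + s *\<^sub>R u) u) (at s)" for s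
    by (intro DERIV_diff has_derivative_along_line f)
  from MVT2[OF \<open>0 < h\<close> this] obtain s where s: "0 < s" "s < h"
    "f ((x + h *\<^sub>R v) + h *\<^sub>R u) - f (x + h *\<^sub>R u) - (f (x + h *\<^sub>R v) - f x) =
      h * (Df ((x + h *\<^sub>R v) + s *\<^sub>R u) u - Df (x + s *\<^sub>R u) u)"
    by auto
  have "((\<lambda>t. Df ((x + s *\<^sub>R u) + t *\<^sub>R v) u) has_real_derivative Du ((x + s *\<^sub>R u) + t *\<^sub>R v) v) (at t)" for t
    by (rule has_derivative_along_line[OF Du])
  from MVT2[OF \<open>0 < h\<close> this] obtain t where t: "0 < t" "t < h"
    "Df ((x + s *\<^sub>R u) + h *\<^sub>R v) u - Df (x + s *\<^sub>R u) u = h * Du ((x + s *\<^sub>R u) + t *\<^sub>R v) v"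
    by auto
  have "x + h *\<^sub>R v + h *\<^sub>R u = x + h *\<^sub>R u + h *\<^sub>R v" "x + h *\<^sub>R v + s *\<^sub>R u = x + s *\<^sub>R u + h *\<^sub>R v"
    by (simp_all add: algebra_simps)
  with s(3) t(3) have "f (x + h *\<^sub>R u + h *\<^sub>R v) - f (x + h *\<^sub>R u) - f (x + h *\<^sub>R v) + f x
       = h * h * Du (x + s *\<^sub>R u + t *\<^sub>R v) v"
    by simp
  with s(1,2) t(1,2) show thesis by (rule that)
qed

text \<open>The second difference over a parallelogram does not change when \<open>u\<close> and
  \<open>v\<close> are exchanged. Evaluated in both orders, it shows that the two mixed derivatives
  agree at two points close to \<open>x\<close>, so by continuity they cannot differ at
  \<open>x\<close>.\<close>

lemma second_derivative_symmetric_real: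
  fixes f :: "'a::real_normed_vector \<Rightarrow> real"
  assumes f: "\<And>y. (f has_derivative Df y) (at y)"
    and Du: "\<And>y. ((\<lambda>y. Df y u) has_derivative Du y) (at y)"
    and Dv: "\<And>y. ((\<lambda>y. Df y v) has_derivative Dv y) (at y)"
    and cu: "isCont (\<lambda>y. Du y v) x" and cv: "isCont (\<lambda>y. Dv y u) x"
  shows "Du x v = Dv x u"
proof (rule ccontr)
  assume neq: "Du x v \<noteq> Dv x u"
  define e where "e = \<bar>Du x v - Dv x u\<bar> / 2"
  have e: "e > 0" using neq by (simp add: e_def)
  obtain d1 where d1: "d1 > 0" "\<And>y. dist y x < d1 \<Longrightarrow> dist (Du y v) (Du x v) < e"
    using cu e unfolding continuous_at_eps_delta by blast
  obtain d2 where d2: "d2 > 0" "\<And>y. dist y x < d2 \<Longrightarrow> dist (Dv y u) (Dv x u) < e"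
    using cv e unfolding continuous_at_eps_delta by blast
  \<comment> \<open>With this \<open>h\<close> the whole parallelogram spanned by
    \<open>h *\<^sub>R u\<close> and \<open>h *\<^sub>R v\<close> lies within
    \<open>min d1 d2\<close> of \<open>x\<close>. The summand 1 covers
    \<open>u = v = 0\<close>.\<close>
  define h where "h = min d1 d2 / (norm u + norm v + 1)"
  have pos: "norm u + norm v + 1 > 0"
    by (smt (verit) norm_ge_zero)
  have h: "h > 0" using d1(1) d2(1) pos by (simp add: h_def)
  have near: "dist (x + s *\<^sub>R a + t *\<^sub>R b) x < min d1 d2"
    if "0 < s" "s < h" "0 < t" "t < h" "norm a + norm b = norm u + norm v" for s t a b
  proof -
    have "dist (x + s *\<^sub>R a + t *\<^sub>R b) x \<le> norm (s *\<^sub>R a) + norm (t *\<^sub>R b)"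
      using norm_triangle_ineq[of "s *\<^sub>R a" "t *\<^sub>R b"] by (simp add: dist_norm add.assoc)
    also have "\<dots> \<le> h * norm a + h * norm b"
      using that by (intro add_mono) (auto intro: mult_right_mono)
    also have "\<dots> = h * (norm u + norm v)"
      using that(5) by (metis distrib_left)
    also have "\<dots> < h * (norm u + norm v + 1)"
      using h by simp
    also have "\<dots> = min d1 d2"
      using pos by (simp add: h_def)
    finally show ?thesis .
  qed
  obtain s t where st: "0 < s" "s < h" "0 < t" "t < h"
    "f (x + h *\<^sub>R u + h *\<^sub>R v) - f (x + h *\<^sub>R u) - f (x + h *\<^sub>R v) + f x
       = h * h * Du (x + s *\<^sub>R u + t *\<^sub>R v) v"
    using second_difference_mean_value[OF f Du h] by blast
  obtain s' t' where st': "0 < s'" "s' < h" "0 < t'" "t' < h"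
    "f (x + h *\<^sub>R v + h *\<^sub>R u) - f (x + h *\<^sub>R v) - f (x + h *\<^sub>R u) + f x
       = h * h * Dv (x + s' *\<^sub>R v + t' *\<^sub>R u) u"
    using second_difference_mean_value[OF f Dv h] by blast
  have "f (x + h *\<^sub>R v + h *\<^sub>R u) = f (x + h *\<^sub>R u + h *\<^sub>R v)"
    by (simp add: algebra_simps)
  then have "h * h * Du (x + s *\<^sub>R u + t *\<^sub>R v) v = h * h * Dv (x + s' *\<^sub>R v + t' *\<^sub>R u) u"
    using st(5) st'(5) by linarith
  then have eq: "Du (x + s *\<^sub>R u + t *\<^sub>R v) v = Dv (x + s' *\<^sub>R v + t' *\<^sub>R u) u"
    using h by simp
  have "dist (Du (x + s *\<^sub>R u + t *\<^sub>R v) v) (Du x v) < e"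
    using near[OF st(1-4), of u v] by (intro d1(2)) simp
  moreover have "dist (Dv (x + s' *\<^sub>R v + t' *\<^sub>R u) u) (Dv x u) < e"
    using near[OF st'(1-4), of v u] by (intro d2(2)) simp
  ultimately have "\<bar>Du x v - Dv x u\<bar> < 2 * e"
    using eq unfolding dist_real_def by linarith
  then show False by (simp add: e_def)
qed

lemma second_derivative_symmetric:
  fixes f :: "'a::real_normed_vector \<Rightarrow> 'b::euclidean_space"
  assumes f: "\<And>y. (f has_derivative Df y) (at y)"
    and Du: "\<And>y. ((\<lambda>y. Df y u) has_derivative Du y) (at y)"
    and Dv: "\<And>y. ((\<lambda>y. Df y v) has_derivative Dv y) (at y)"
    and cu: "isCont (\<lambda>y. Du y v) x" and cv: "isCont (\<lambda>y. Dv y u) x"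
  shows "Du x v = Dv x u"
proof (rule euclidean_eqI)
  fix b :: 'b
  show "Du x v \<bullet> b = Dv x u \<bullet> b"
    by (rule second_derivative_symmetric_real[of "\<lambda>y. f y \<bullet> b" "\<lambda>y h. Df y h \<bullet> b" u "\<lambda>y h. Du y h \<bullet> b" v "\<lambda>y h. Dv y h \<bullet> b"])
      (intro has_derivative_inner_left f Du Dv isCont_inner cu cv continuous_const)+
qed

lemma
  fixes g :: "real^'m \<Rightarrow> real^'k"
  assumes "times_diff (Suc (Suc 0)) g"
  shows has_derivative_Jac: "(g has_derivative (\<lambda>v. Jac g q *v v)) (at q)"
    and C1_Jac: "C1 (\<lambda>q. Jac g q)"
proof -
  show "(g has_derivative (\<lambda>v. Jac g q *v v)) (at q)"
    using assms jacobian_works[of g "at q"] by simp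
  have "C1 (\<lambda>q. \<chi> i j. frechet_derivative g (at q) (axis j 1) $ i)"
    using assms by (intro C1_vec_lambda C1_vec_nth times_diff_1_imp_C1) simp
  then show "C1 (\<lambda>q. Jac g q)"
    by (simp add: jacobian_def matrix_def)
qed

lemma C1_if_times_diff_2:
  fixes g :: "real^'m \<Rightarrow> real^'k"
  assumes "times_diff (Suc (Suc 0)) g" shows "C1 g"
  by (rule C1I[OF has_derivative_Jac[OF assms]])
    (intro C1_continuous_on C1_matrix_vector C1_Jac C1_const assms)

lemma
  fixes U :: "real^'m \<Rightarrow> real"
  assumes "times_diff (Suc (Suc 0)) U"
  shows has_derivative_grad: "(U has_derivative (\<lambda>v. grad U q \<bullet> v)) (at q)"
    and C1_grad: "C1 (grad U)"
proof -
  have d: "(U has_derivative frechet_derivative U (at q)) (at q)"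
    using assms frechet_derivative_works[of U "at q"] by simp
  have "frechet_derivative U (at q) v = grad U q \<bullet> v" for v
  proof -
    have lin: "linear (frechet_derivative U (at q))"
      using d has_derivative_linear by blast
    have "frechet_derivative U (at q) (\<Sum>i\<in>UNIV. v $ i *\<^sub>R axis i 1)
        = (\<Sum>i\<in>UNIV. v $ i * frechet_derivative U (at q) (axis i 1))"
      by (simp add: linear_sum[OF lin] linear_scale[OF lin])
    moreover have "(\<Sum>i\<in>UNIV. v $ i *\<^sub>R axis i 1) = v"
      using basis_expansion[of v] by (simp add: scalar_mult_eq_scaleR)
    ultimately show ?thesis
      by (simp add: grad_def inner_vec_def mult.commute)
  qed
  with d show "(U has_derivative (\<lambda>v. grad U q \<bullet> v)) (at q)"
    by (metis (no_types, lifting) ext)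
  have "C1 (\<lambda>q. \<chi> i. frechet_derivative U (at q) (axis i 1))"
    using assms by (intro C1_vec_lambda times_diff_1_imp_C1) simp
  then show "C1 (grad U)"
    by (simp add: grad_def[abs_def])
qed

text \<open>Symmetry of the Hessians of the components of \<open>g\<close>. Because of it the
  multiplier-weighted Hessian, which appears in the derivative of a kick, drops out of the
  antisymmetric part of the form.\<close>

lemma Jac_derivative_symmetric:
  fixes g :: "real^'m \<Rightarrow> real^'k"
  assumes g: "times_diff (Suc (Suc 0)) g" and H: "((\<lambda>q. Jac g q) has_derivative H) (at q)"
  shows "H u *v v = H v *v u"
proof -
  obtain D where D: "\<And>x. ((\<lambda>q. Jac g q) has_derivative D x) (at x)"
    "continuous_on UNIV (\<lambda>p. D (fst p) (snd p))"
    using C1_derivE[OF C1_Jac[OF g]] by blast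
  have H_eq: "H = D q"
    using has_derivative_unique[OF H D(1)] .
  have cont: "isCont (\<lambda>y. D y a *v b) q" for a b
    by (intro bounded_bilinear.isCont[OF bounded_bilinear_matrix_vector] continuous_const)
      (use continuous_on_apply2[OF D(2) continuous_on_id continuous_on_const, of UNIV a]
        in \<open>simp add: continuous_on_eq_continuous_at\<close>)
  show ?thesis unfolding H_eq
    by (rule second_derivative_symmetric[OF has_derivative_Jac[OF g], where x = q, symmetric])
      (auto intro!: cont bounded_linear.has_derivative[OF
          bounded_bilinear.bounded_linear_left[OF bounded_bilinear_matrix_vector]] D(1))
qed

lemma grad_derivative_symmetric:
  fixes U :: "real^'m \<Rightarrow> real"
  assumes U: "times_diff (Suc (Suc 0)) U" and H: "(grad U has_derivative H) (at q)"
  shows "H u \<bullet> v = H v \<bullet> u"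
proof -
  obtain D where D: "\<And>x. (grad U has_derivative D x) (at x)"
    "continuous_on UNIV (\<lambda>p. D (fst p) (snd p))"
    using C1_derivE[OF C1_grad[OF U]] by blast
  have H_eq: "H = D q"
    using has_derivative_unique[OF H D(1)] .
  have cont: "isCont (\<lambda>y. D y a \<bullet> b) q" for a b
    by (intro isCont_inner continuous_const)
      (use continuous_on_apply2[OF D(2) continuous_on_id continuous_on_const, of UNIV a]
        in \<open>simp add: continuous_on_eq_continuous_at\<close>)
  show ?thesis unfolding H_eq
    by (rule second_derivative_symmetric[OF has_derivative_grad[OF U], where x = q, symmetric])
      (auto intro!: cont has_derivative_inner_left D(1))
qed

subsection \<open>The free magnetic flow\<close>

lemma bounded_bilinear_matrix_matrix:
  "bounded_bilinear ((**) :: real^'n^'m \<Rightarrow> real^'k^'n \<Rightarrow> real^'k^'m)"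
  unfolding bilinear_conv_bounded_bilinear[symmetric] bilinear_def
  by (auto intro!: linearI simp: vec_eq_iff matrix_matrix_mult_def sum.distrib algebra_simps sum_distrib_left)

lemma bounded_linear_matrix_apply: "bounded_linear (\<lambda>A :: real^'n^'m. A *v v)"
  by (rule bounded_bilinear.bounded_linear_left[OF bounded_bilinear_matrix_vector])

lemma matrix_power_scaleR:
  fixes A :: "real^'n^'n"
  shows "((\<lambda>X. (c *\<^sub>R A) ** X) ^^ n) (mat 1) = c ^ n *\<^sub>R ((\<lambda>X. A ** X) ^^ n) (mat 1)"
  by (induction n) (simp_all add: bounded_bilinear.scaleR_left[OF bounded_bilinear_matrix_matrix]
      bounded_bilinear.scaleR_right[OF bounded_bilinear_matrix_matrix] mult.commute)

lemma matrix_power_commute: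
  fixes A :: "real^'n^'n"
  shows "A ** ((\<lambda>X. A ** X) ^^ n) (mat 1) = ((\<lambda>X. A ** X) ^^ n) (mat 1) ** A"
  by (induction n) (simp_all, metis matrix_mul_assoc)

text \<open>The norm of matrices is submultiplicative up to a constant \<open>K\<close>, so the
  terms are dominated by the exponential series of \<open>norm A * K\<close>.\<close>

lemma summable_mat_exp:
  fixes A :: "real^'n^'n"
  shows "summable (\<lambda>n. (1 / fact n) *\<^sub>R ((\<lambda>X. A ** X) ^^ n) (mat 1))"
proof -
  obtain K where K: "K > 0" "\<And>a b. norm ((a :: real^'n^'n) ** (b :: real^'n^'n)) \<le> norm a * norm b * K"
    using bounded_bilinear.pos_bounded[OF bounded_bilinear_matrix_matrix] by blast
  have bound: "norm (((\<lambda>X. A ** X) ^^ n) (mat 1)) \<le> (norm A * K) ^ n * norm (mat 1 :: real^'n^'n)" for n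
  proof (induction n)
    case (Suc n)
    have "norm (((\<lambda>X. A ** X) ^^ Suc n) (mat 1)) \<le> norm A * norm (((\<lambda>X. A ** X) ^^ n) (mat 1)) * K"
      using K(2) by simp
    also have "\<dots> \<le> norm A * ((norm A * K) ^ n * norm (mat 1 :: real^'n^'n)) * K"
      using K(1) Suc by (intro mult_right_mono mult_left_mono) auto
    finally show ?case by (simp add: mult_ac)
  qed simp
  have "summable (\<lambda>n. (norm A * K) ^ n /\<^sub>R fact n * norm (mat 1 :: real^'n^'n))"
    by (intro summable_mult2 summable_exp_generic)
  then show ?thesis
  proof (rule summable_comparison_test'[where N = 0])
    show "norm ((1 / fact n) *\<^sub>R ((\<lambda>X. A ** X) ^^ n) (mat 1))
        \<le> (norm A * K) ^ n /\<^sub>R fact n * norm (mat 1 :: real^'n^'n)" for n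
      using bound[of n] by (simp add: divide_simps)
  qed
qed

lemma mat_exp_commute: "A ** mat_exp (t *\<^sub>R A) = mat_exp (t *\<^sub>R A) ** A"
proof -
  have "A ** mat_exp (t *\<^sub>R A) = (\<Sum>n. A ** ((1 / fact n) *\<^sub>R ((\<lambda>X. (t *\<^sub>R A) ** X) ^^ n) (mat 1)))"
    unfolding mat_exp_def
    by (rule bounded_linear.suminf[OF bounded_bilinear.bounded_linear_right[OF bounded_bilinear_matrix_matrix] summable_mat_exp])
  also have "\<dots> = (\<Sum>n. ((1 / fact n) *\<^sub>R ((\<lambda>X. (t *\<^sub>R A) ** X) ^^ n) (mat 1)) ** A)"
  proof (rule suminf_cong)
    fix n
    have "A ** (c *\<^sub>R d *\<^sub>R P) = (c *\<^sub>R d *\<^sub>R P) ** A" if "A ** P = P ** A" for c d P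
      by (simp only: bounded_bilinear.scaleR_left[OF bounded_bilinear_matrix_matrix]
          bounded_bilinear.scaleR_right[OF bounded_bilinear_matrix_matrix] that)
    then show "A ** ((1 / fact n) *\<^sub>R ((\<lambda>X. (t *\<^sub>R A) ** X) ^^ n) (mat 1))
        = ((1 / fact n) *\<^sub>R ((\<lambda>X. (t *\<^sub>R A) ** X) ^^ n) (mat 1)) ** A"
      unfolding matrix_power_scaleR using matrix_power_commute by blast
  qed
  also have "\<dots> = mat_exp (t *\<^sub>R A) ** A"
    unfolding mat_exp_def
    by (rule bounded_linear.suminf[OF bounded_bilinear.bounded_linear_left[OF bounded_bilinear_matrix_matrix] summable_mat_exp, symmetric])
  finally show ?thesis .
qed

lemma mat_exp_0: "mat_exp (0 :: real^'n^'n) = mat 1"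
proof -
  have *: "(1 / fact n) *\<^sub>R ((\<lambda>X. (0 :: real^'n^'n) ** X) ^^ n) (mat 1) = (if n = 0 then mat 1 else 0)" for n
    by (cases n) (simp_all add: bounded_bilinear.zero_left[OF bounded_bilinear_matrix_matrix])
  show ?thesis
    unfolding mat_exp_def * by (subst suminf_finite[of "{0::nat}"]) auto
qed

text \<open>Paired with a fixed matrix \<open>b\<close>, the exponential becomes a real power series
  in \<open>t\<close>, which may be differentiated term by term. The componentwise criterion then
  returns to matrices.\<close>

lemma has_vector_derivative_mat_exp:
  fixes A :: "real^'n^'n"
  shows "((\<lambda>t. mat_exp (t *\<^sub>R A)) has_vector_derivative A ** mat_exp (t *\<^sub>R A)) (at t)"
proof -
  let ?P = "\<lambda>n. ((\<lambda>X. A ** X) ^^ n) (mat 1)"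
  have "((\<lambda>t. mat_exp (t *\<^sub>R A) \<bullet> b) has_real_derivative (A ** mat_exp (t *\<^sub>R A)) \<bullet> b) (at t)" for b
  proof -
    define c where "c = (\<lambda>n. (1 / fact n) * (?P n \<bullet> b))"
    have inner: "bounded_linear (\<lambda>x. x \<bullet> b)"
      by (rule bounded_linear_inner_left)
    have term_eq: "c n * s ^ n = ((1 / fact n) *\<^sub>R ((\<lambda>X. (s *\<^sub>R A) ** X) ^^ n) (mat 1)) \<bullet> b" for n s
      by (simp add: c_def matrix_power_scaleR)
    have sum_c: "summable (\<lambda>n. c n * s ^ n)" for s
      unfolding term_eq by (rule bounded_linear.summable[OF inner summable_mat_exp])
    have eq1: "mat_exp (s *\<^sub>R A) \<bullet> b = (\<Sum>n. c n * s ^ n)" for s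
      unfolding mat_exp_def term_eq by (rule bounded_linear.suminf[OF inner summable_mat_exp])
    \<comment> \<open>The shifted coefficient (n+1) c_{n+1} equals (1/n!) times the pairing of
      A^{n+1} with \<open>b\<close>; this splits off one factor \<open>A\<close> on the
      left.\<close>
    have dc: "diffs c n * s ^ n = (A ** ((1 / fact n) *\<^sub>R ((\<lambda>X. (s *\<^sub>R A) ** X) ^^ n) (mat 1))) \<bullet> b" for n s
      by (simp add: diffs_def c_def matrix_power_scaleR bounded_bilinear.scaleR_right[OF bounded_bilinear_matrix_matrix]
          field_simps del: of_nat_Suc)
    have bl: "bounded_linear (\<lambda>X. (A ** X) \<bullet> b)"
      by (rule bounded_linear_compose[OF inner bounded_bilinear.bounded_linear_right[OF bounded_bilinear_matrix_matrix]])
    have eq2: "(A ** mat_exp (t *\<^sub>R A)) \<bullet> b = (\<Sum>n. diffs c n * t ^ n)"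
      unfolding mat_exp_def dc by (rule bounded_linear.suminf[OF bl summable_mat_exp])
    show ?thesis
      unfolding eq1 eq2 by (rule termdiffs_strong_converges_everywhere[OF sum_c])
  qed
  then show ?thesis
    unfolding has_vector_derivative_def has_derivative_componentwise_within[of "\<lambda>t. mat_exp (t *\<^sub>R A)"]
      has_field_derivative_def
    by (simp add: mult_commute_abs)
qed

section \<open>The rotation and drift matrices of the free flow\<close>

definition rot :: "real^'m^'m \<Rightarrow> real \<Rightarrow> real^'m^'m" where
  "rot L t = mat_exp ((- t) *\<^sub>R L)"

definition drift :: "real^'m^'m \<Rightarrow> real \<Rightarrow> real^'m^'m" where
  "drift L t = (LBINT s=ereal 0..ereal t. rot L s)"

lemma rot_0: "rot L 0 = mat 1"
  by (simp add: rot_def mat_exp_0)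

lemma has_vector_derivative_rot: "(rot L has_vector_derivative - (L ** rot L t)) (at t)"
proof -
  have "((\<lambda>t. mat_exp (t *\<^sub>R (- L))) has_vector_derivative (- L) ** mat_exp (t *\<^sub>R (- L))) (at t)"
    by (rule has_vector_derivative_mat_exp)
  then show ?thesis
    by (simp add: rot_def[abs_def] bounded_bilinear.minus_left[OF bounded_bilinear_matrix_matrix])
qed

lemma rot_commute: "L ** rot L t = rot L t ** L"
  unfolding rot_def by (rule mat_exp_commute)

lemma continuous_on_rot: "continuous_on S (rot L)"
  by (rule continuous_on_vector_derivative)
    (rule has_vector_derivative_at_within[OF has_vector_derivative_rot])

text \<open>A primitive \<open>F\<close> of \<open>rot L\<close> exists by continuity. The
  fundamental theorem for oriented integrals then evaluates both the matrix integral and the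
  integral of \<open>rot L s *v p\<close> by \<open>F\<close>, which shows that the displacement is
  a matrix applied to \<open>p\<close>.\<close>

lemma
  shows drift_0: "drift L 0 = 0"
    and has_vector_derivative_drift: "(drift L has_vector_derivative rot L t) (at t)"
    and flow2_eq: "flow2 L \<epsilon> (q, p) = (q + drift L \<epsilon> *v p, rot L \<epsilon> *v p)"
proof -
  have "\<exists>F. \<forall>x::real. -\<infinity> < ereal x \<longrightarrow> ereal x < \<infinity> \<longrightarrow> (F has_vector_derivative rot L x) (at x)"
    using continuous_on_rot[of UNIV L]
    by (intro einterval_antiderivative) (auto simp: continuous_on_eq_continuous_at)
  then obtain F where F: "\<And>x. (F has_vector_derivative rot L x) (at x)"
    by auto
  have drift: "drift L t = F t - F 0" for t
    unfolding drift_def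
    by (rule interval_integral_FTC_finite)
      (auto intro: continuous_on_rot has_vector_derivative_at_within F)
  then show "drift L 0 = 0" by simp
  have "((\<lambda>t. F t - F 0) has_vector_derivative rot L t) (at t)"
    using has_vector_derivative_diff[OF F has_vector_derivative_const] by simp
  then show "(drift L has_vector_derivative rot L t) (at t)"
    unfolding ext[of "drift L" "\<lambda>t. F t - F 0", OF drift] .
  have "(LBINT s=ereal 0..ereal \<epsilon>. rot L s *v p) = F \<epsilon> *v p - F 0 *v p"
  proof (rule interval_integral_FTC_finite)
    show "continuous_on {min 0 \<epsilon>..max 0 \<epsilon>} (\<lambda>s. rot L s *v p)"
      by (rule bounded_linear.continuous_on[OF bounded_linear_matrix_apply continuous_on_rot])
    show "((\<lambda>s. F s *v p) has_vector_derivative rot L x *v p) (at x within {min 0 \<epsilon>..max 0 \<epsilon>})" for x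
      by (rule has_vector_derivative_at_within)
        (rule bounded_linear.has_vector_derivative[OF bounded_linear_matrix_apply F])
  qed
  then show "flow2 L \<epsilon> (q, p) = (q + drift L \<epsilon> *v p, rot L \<epsilon> *v p)"
    by (simp add: flow2_def drift rot_def matrix_vector_mult_diff_rdistrib)
qed

lemma has_vector_derivative_0_imp_const:
  assumes "\<And>t. (f has_vector_derivative 0) (at t)" shows "f t = f 0"
  using has_vector_derivative_zero_constant[of UNIV f] assms by (metis UNIV_I convex_UNIV)

text \<open>Most identities between \<open>rot\<close>, \<open>drift\<close> and their transposes
  are obtained by comparing derivatives and values at 0, so that the exponential series need not be
  reopened.\<close>

lemma eq_if_same_vector_derivative:
  assumes "\<And>t. (f has_vector_derivative f' t) (at t)" "\<And>t. (g has_vector_derivative f' t) (at t)" "f 0 = g 0"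
  shows "f t = g t"
  using has_vector_derivative_0_imp_const[of "\<lambda>t. f t - g t" t]
    has_vector_derivative_diff[OF assms(1,2)] assms(3) by simp

lemmas has_vector_derivative_transpose =
  bounded_linear.has_vector_derivative[OF bounded_linear_transpose]

lemmas has_vector_derivative_matrix_mult =
  bounded_bilinear.has_vector_derivative[OF bounded_bilinear_matrix_matrix]

text \<open>The derivative of the left side is LR - LR = 0. In terms of the motion q' = p, p' = -Lp
  this is conservation of p + Lq.\<close>

lemma rot_drift: "L ** drift L t + rot L t = mat 1"
proof -
  have "((\<lambda>t. L ** drift L t + rot L t) has_vector_derivative (L ** rot L t + - (L ** rot L t))) (at t)" for t
    by (intro has_vector_derivative_add has_vector_derivative_rot has_vector_derivative_drift
        bounded_linear.has_vector_derivative[OF bounded_bilinear.bounded_linear_right[OF bounded_bilinear_matrix_matrix]])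
  then have "L ** drift L t + rot L t = L ** drift L 0 + rot L 0"
    by (intro has_vector_derivative_0_imp_const[of "\<lambda>t. L ** drift L t + rot L t"]) simp
  then show ?thesis
    by (simp add: drift_0 rot_0)
qed

lemma rot_uminus: "rot L (- t) ** rot L t = mat 1"
proof -
  have m: "((\<lambda>t. rot L (- t)) has_vector_derivative (L ** rot L (- t))) (at t)" for t
  proof -
    have "((\<lambda>t. mat_exp (t *\<^sub>R L)) has_vector_derivative L ** mat_exp (t *\<^sub>R L)) (at t)"
      by (rule has_vector_derivative_mat_exp)
    then show ?thesis by (simp add: rot_def)
  qed
  have "((\<lambda>t. rot L (- t) ** rot L t) has_vector_derivative
      (rot L (- t) ** (- (L ** rot L t)) + (L ** rot L (- t)) ** rot L t)) (at t)" for t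
    by (rule has_vector_derivative_matrix_mult[OF m has_vector_derivative_rot])
  moreover have "rot L (- t) ** (- (L ** rot L t)) + (L ** rot L (- t)) ** rot L t = 0" for t
    unfolding rot_commute[of L "- t"] bounded_bilinear.minus_right[OF bounded_bilinear_matrix_matrix]
    by (simp add: matrix_mul_assoc)
  ultimately have "((\<lambda>t. rot L (- t) ** rot L t) has_vector_derivative 0) (at t)" for t
    by (simp only:)
  then have "rot L (- t) ** rot L t = rot L (- 0) ** rot L 0"
    by (rule has_vector_derivative_0_imp_const)
  then show ?thesis by (simp add: rot_0)
qed

context
  fixes L :: "real^'m^'m"
  assumes skew: "transpose L = - L"
begin

lemma has_vector_derivative_transpose_rot:
  "((\<lambda>t. transpose (rot L t)) has_vector_derivative transpose (rot L t) ** L) (at t)"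
proof -
  have "transpose (- (L ** rot L t)) = transpose (rot L t) ** L"
    by (simp add: matrix_transpose_mul skew linear_neg[OF bounded_linear.linear[OF bounded_linear_transpose]]
        bounded_bilinear.minus_right[OF bounded_bilinear_matrix_matrix])
  then show ?thesis
    using has_vector_derivative_transpose[OF has_vector_derivative_rot[of L t]] by simp
qed

lemma transpose_rot_rot: "transpose (rot L t) ** rot L t = mat 1"
proof -
  have "((\<lambda>t. transpose (rot L t) ** rot L t) has_vector_derivative
     (transpose (rot L t) ** (- (L ** rot L t)) + (transpose (rot L t) ** L) ** rot L t)) (at t)" for t
    by (rule has_vector_derivative_matrix_mult[OF has_vector_derivative_transpose_rot has_vector_derivative_rot])
  then have "transpose (rot L t) ** rot L t = transpose (rot L 0) ** rot L 0"
    by (intro has_vector_derivative_0_imp_const[of "\<lambda>t. transpose (rot L t) ** rot L t"])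
      (simp add: matrix_mul_assoc bounded_bilinear.minus_right[OF bounded_bilinear_matrix_matrix])
  then show ?thesis by (simp add: rot_0 transpose_mat)
qed

lemma rot_uminus_eq_transpose: "rot L (- t) = transpose (rot L t)"
proof -
  have "rot L t ** transpose (rot L t) = mat 1"
    using transpose_rot_rot matrix_left_right_inverse by blast
  then have "rot L (- t) = rot L (- t) ** (rot L t ** transpose (rot L t))"
    by (simp only: matrix_mul_rid)
  also have "\<dots> = transpose (rot L t)"
    by (simp only: matrix_mul_assoc rot_uminus matrix_mul_lid)
  finally show ?thesis .
qed

text \<open>With R = \<open>rot L t\<close> and A = \<open>drift L t\<close>, the right side has
  derivative R^T R + R^T L A = R^T (R + L A), which is R^T by \<open>rot_drift\<close>. This is also
  the derivative of A^T, and both sides vanish at 0.\<close>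

lemma transpose_drift: "transpose (drift L t) = transpose (rot L t) ** drift L t"
proof (rule eq_if_same_vector_derivative)
  show "((\<lambda>t. transpose (drift L t)) has_vector_derivative transpose (rot L t)) (at t)" for t
    by (rule has_vector_derivative_transpose[OF has_vector_derivative_drift])
  have "((\<lambda>t. transpose (rot L t) ** drift L t) has_vector_derivative
     (transpose (rot L t) ** rot L t + (transpose (rot L t) ** L) ** drift L t)) (at t)" for t
    by (rule has_vector_derivative_matrix_mult[OF has_vector_derivative_transpose_rot has_vector_derivative_drift])
  moreover have "transpose (rot L t) ** rot L t + (transpose (rot L t) ** L) ** drift L t = transpose (rot L t)" for t
    using arg_cong[OF rot_drift[of L t], of "\<lambda>X. transpose (rot L t) ** X"]
    by (simp add: matrix_mul_assoc matrix_add_ldistrib add.commute)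
  ultimately show "((\<lambda>t. transpose (rot L t) ** drift L t) has_vector_derivative transpose (rot L t)) (at t)" for t
    by (simp only:)
qed (simp add: drift_0 transpose_def vec_eq_iff matrix_matrix_mult_def)

lemma drift_uminus: "drift L (- t) = - transpose (drift L t)"
proof (rule eq_if_same_vector_derivative)
  show "((\<lambda>t. - transpose (drift L t)) has_vector_derivative - transpose (rot L t)) (at t)" for t
    by (intro has_vector_derivative_minus has_vector_derivative_transpose has_vector_derivative_drift)
  have "((\<lambda>t. drift L (- t)) has_vector_derivative (- 1) *\<^sub>R rot L (- t)) (at t)" for t
    using vector_diff_chain_at[of uminus "-1" t "drift L" "rot L (-t)"]
      has_vector_derivative_drift[of L "-t"] has_vector_derivative_minus[OF has_vector_derivative_id]
    by (simp add: o_def)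
  then show "((\<lambda>t. drift L (- t)) has_vector_derivative - transpose (rot L t)) (at t)" for t
    by (simp add: rot_uminus_eq_transpose)
qed (simp add: drift_0 transpose_def vec_eq_iff)

end

lemma C1_if_has_vector_derivative:
  assumes "\<And>t. (f has_vector_derivative f' t) (at t)" "continuous_on UNIV f'"
  shows "C1 f"
  by (rule C1I[OF assms(1)[unfolded has_vector_derivative_def]]) (intro continuous_intros assms(2))

lemma C1_drift: "C1 (drift L)"
  by (rule C1_if_has_vector_derivative[OF has_vector_derivative_drift continuous_on_rot])

lemma C1_rot: "C1 (rot L)"
  by (rule C1_if_has_vector_derivative[OF has_vector_derivative_rot])
    (intro continuous_on_minus continuous_on_rot
      bounded_linear.continuous_on[OF bounded_bilinear.bounded_linear_right[OF bounded_bilinear_matrix_matrix]])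

subsection \<open>Preservation of the magnetic form\<close>

lemma inner_transpose_right: "a \<bullet> (transpose A *v b) = (A *v a) \<bullet> (b :: real^_)"
  by (metis dot_lmul_matrix inner_commute vector_transpose_matrix)

lemma inner_transpose_left: "(transpose A *v b) \<bullet> a = b \<bullet> (A *v (a :: real^_))"
  by (metis inner_commute inner_transpose_right)

lemma Omega_mag_eq:
  "Omega_mag L u v = fst u \<bullet> (L *v fst v) + fst u \<bullet> snd v - snd u \<bullet> fst v"
  by (simp add: Omega_mag_def J_mag_def inner_prod_def inner_right_distrib)

lemma transpose_full_rank_eq_0:
  fixes A :: "real^'m^'k"
  assumes "rank A = CARD('k)" and "transpose A *v x = 0" shows "x = 0"
proof -
  have "inj ((*v) (transpose A))"
    using assms(1) by (simp add: full_rank_injective[symmetric] rank_transpose)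
  then show ?thesis
    using assms(2) by (metis injD matrix_vector_mult_0_right)
qed

section \<open>Tangent vectors and derivatives within a set\<close>

lemma has_vector_derivative_compose_curve:
  assumes \<Phi>: "(\<Phi> has_derivative D) (at z within S)"
    and \<gamma>: "\<gamma> 0 = z" "\<forall>\<^sub>F t in nhds 0. \<gamma> t \<in> S" "(\<gamma> has_vector_derivative v) (at (0::real))"
  shows "((\<lambda>t. \<Phi> (\<gamma> t)) has_vector_derivative D v) (at 0)"
proof -
  \<comment> \<open>The curve lies in \<open>S\<close> only for small parameters. The chain rule is
    used on this open \<open>T\<close>, and openness then removes the restriction at 0.\<close>
  obtain T where T: "open T" "0 \<in> T" "\<gamma> ` T \<subseteq> S"
    using \<gamma>(2) unfolding eventually_nhds by blast
  have "(\<gamma> has_derivative (\<lambda>h. h *\<^sub>R v)) (at 0 within T)"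
    using \<gamma>(3) has_derivative_at_withinI unfolding has_vector_derivative_def by blast
  moreover have "(\<Phi> has_derivative D) (at (\<gamma> 0) within \<gamma> ` T)"
    using has_derivative_subset[OF \<Phi> T(3)] \<gamma>(1) by simp
  ultimately have "((\<lambda>t. \<Phi> (\<gamma> t)) has_derivative (\<lambda>h. D (h *\<^sub>R v))) (at 0 within T)"
    by (rule has_derivative_in_compose)
  then show ?thesis
    using linear_scale[OF has_derivative_linear[OF \<Phi>]] at_within_open[OF T(2,1)]
    by (simp add: has_vector_derivative_def)
qed

lemma tangent_space_image:
  assumes \<Phi>: "(\<Phi> has_derivative D) (at z within S)"
    and S: "\<forall>\<^sub>F w in nhds z. w \<in> S \<longrightarrow> \<Phi> w \<in> S"
    and u: "u \<in> tangent_space S z"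
  shows "D u \<in> tangent_space S (\<Phi> z)"
proof -
  obtain \<gamma> where \<gamma>: "\<gamma> 0 = z" "\<forall>\<^sub>F t in nhds 0. \<gamma> t \<in> S" "(\<gamma> has_vector_derivative u) (at (0::real))"
    using u unfolding tangent_space_def by blast
  have "isCont \<gamma> 0"
    using \<gamma>(3) has_vector_derivative_continuous by blast
  then have "filterlim \<gamma> (nhds z) (nhds 0)"
    using \<gamma>(1) tendsto_at_iff_tendsto_nhds[of \<gamma> 0] by (simp add: isCont_def)
  then have "\<forall>\<^sub>F t in nhds 0. \<gamma> t \<in> S \<longrightarrow> \<Phi> (\<gamma> t) \<in> S"
    using S unfolding filterlim_iff by blast
  then have "\<forall>\<^sub>F t in nhds 0. \<Phi> (\<gamma> t) \<in> S"
    using \<gamma>(2) by eventually_elim blast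
  moreover have "((\<lambda>t. \<Phi> (\<gamma> t)) has_vector_derivative D u) (at 0)"
    by (rule has_vector_derivative_compose_curve[OF \<Phi> \<gamma>])
  ultimately show ?thesis
    unfolding tangent_space_def using \<gamma>(1) by (intro CollectI exI[of _ "\<lambda>t. \<Phi> (\<gamma> t)"]) simp
qed

text \<open>Made to be closed under composition: local invariance of \<open>S\<close> carries
  tangent vectors to tangent vectors and allows the next map to be differentiated within
  \<open>S\<close>. It is asked only near \<open>z\<close>, since a step is controlled only where
  its multipliers are known to be unique.\<close>

definition preserves_form_at ::
  "'a::real_normed_vector set \<Rightarrow> ('a \<Rightarrow> 'a \<Rightarrow> real) \<Rightarrow> ('a \<Rightarrow> 'a) \<Rightarrow> 'a \<Rightarrow> bool" where
  "preserves_form_at S \<Omega> \<Phi> z \<longleftrightarrow>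
     (\<forall>\<^sub>F w in nhds z. w \<in> S \<longrightarrow> \<Phi> w \<in> S) \<and>
     (\<exists>D. (\<Phi> has_derivative D) (at z within S) \<and>
        (\<forall>u\<in>tangent_space S z. \<forall>v\<in>tangent_space S z. \<Omega> (D u) (D v) = \<Omega> u v))"

lemma preserves_form_at_id: "preserves_form_at S \<Omega> (\<lambda>w. w) z"
  unfolding preserves_form_at_def by (auto intro!: exI[of _ "\<lambda>w. w"])

lemma preserves_form_at_compose:
  assumes \<Phi>: "preserves_form_at S \<Omega> \<Phi> z" and \<Psi>: "preserves_form_at S \<Omega> \<Psi> (\<Phi> z)"
  shows "preserves_form_at S \<Omega> (\<lambda>w. \<Psi> (\<Phi> w)) z"
proof -
  obtain D where D: "(\<Phi> has_derivative D) (at z within S)"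
    "\<And>u v. u \<in> tangent_space S z \<Longrightarrow> v \<in> tangent_space S z \<Longrightarrow> \<Omega> (D u) (D v) = \<Omega> u v"
    using \<Phi> unfolding preserves_form_at_def by blast
  obtain E where E: "(\<Psi> has_derivative E) (at (\<Phi> z) within S)"
    "\<And>u v. u \<in> tangent_space S (\<Phi> z) \<Longrightarrow> v \<in> tangent_space S (\<Phi> z) \<Longrightarrow> \<Omega> (E u) (E v) = \<Omega> u v"
    using \<Psi> unfolding preserves_form_at_def by blast
  have S\<Phi>: "\<forall>\<^sub>F w in nhds z. w \<in> S \<longrightarrow> \<Phi> w \<in> S"
    and S\<Psi>: "\<forall>\<^sub>F w in nhds (\<Phi> z). w \<in> S \<longrightarrow> \<Psi> w \<in> S"
    using \<Phi> \<Psi> unfolding preserves_form_at_def by auto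
  \<comment> \<open>Differentiability within \<open>S\<close> gives continuity along
    \<open>S\<close> only, so the neighbourhood of \<open>\<Phi> z\<close> pulls back to a punctured
    one of \<open>z\<close> in \<open>S\<close>. The point \<open>z\<close> itself is restored by
    evaluating \<open>S\<Psi>\<close> at its centre.\<close>
  have "(\<Phi> \<longlongrightarrow> \<Phi> z) (at z within S)"
    using has_derivative_continuous[OF D(1)] by (simp add: continuous_within)
  then have "\<forall>\<^sub>F w in at z within S. \<Phi> w \<in> S \<longrightarrow> \<Psi> (\<Phi> w) \<in> S"
    using S\<Psi> unfolding filterlim_iff by blast
  then have "\<forall>\<^sub>F w in nhds z. w \<noteq> z \<longrightarrow> w \<in> S \<longrightarrow> \<Phi> w \<in> S \<longrightarrow> \<Psi> (\<Phi> w) \<in> S"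
    unfolding eventually_at_filter .
  then have "\<forall>\<^sub>F w in nhds z. w \<in> S \<longrightarrow> \<Phi> w \<in> S \<longrightarrow> \<Psi> (\<Phi> w) \<in> S"
    by (rule eventually_mono) (use eventually_nhds_x_imp_x[OF S\<Psi>] in blast)
  then have inv: "\<forall>\<^sub>F w in nhds z. w \<in> S \<longrightarrow> \<Psi> (\<Phi> w) \<in> S"
    using S\<Phi> by eventually_elim blast
  \<comment> \<open>The derivative of \<open>\<Psi>\<close> is one within \<open>S\<close>, and
    \<open>\<Phi>\<close> is known to map \<open>S\<close> into \<open>S\<close> only on
    \<open>N\<close>. Cutting down to an open neighbourhood does not affect the derivative at
    \<open>z\<close>.\<close>
  obtain N where N: "open N" "z \<in> N" "\<And>w. w \<in> N \<Longrightarrow> w \<in> S \<Longrightarrow> \<Phi> w \<in> S"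
    using S\<Phi> unfolding eventually_nhds by blast
  have "((\<lambda>w. \<Psi> (\<Phi> w)) has_derivative (\<lambda>h. E (D h))) (at z within S \<inter> N)"
  proof -
    have "(\<Phi> has_derivative D) (at z within S \<inter> N)"
      by (rule has_derivative_subset[OF D(1)]) simp
    moreover have "(\<Psi> has_derivative E) (at (\<Phi> z) within \<Phi> ` (S \<inter> N))"
      by (rule has_derivative_subset[OF E(1)]) (use N(3) in auto)
    ultimately show ?thesis
      by (rule has_derivative_in_compose)
  qed
  then have "((\<lambda>w. \<Psi> (\<Phi> w)) has_derivative (\<lambda>h. E (D h))) (at z within S)"
    using at_within_nhd[OF N(2,1), of "S \<inter> N" S] by (simp add: Int_absorb2 inf.assoc)
  moreover have "\<Omega> (E (D u)) (E (D v)) = \<Omega> u v"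
    if "u \<in> tangent_space S z" "v \<in> tangent_space S z" for u v
    using that tangent_space_image[OF D(1) S\<Phi>] by (simp add: D(2) E(2))
  ultimately show ?thesis
    unfolding preserves_form_at_def using inv by blast
qed

text \<open>The derivative selected in \<open>pullback_on\<close> may differ from the
  \<open>D\<close> that preserves the form. On the velocity of a curve in \<open>S\<close>, however,
  both return the velocity of the image curve, so they agree on tangent vectors.\<close>

lemma preserves_form_at_imp_pullback:
  assumes "preserves_form_at S \<Omega> \<Phi> z"
  shows "\<Phi> differentiable (at z within S)"
    and "u \<in> tangent_space S z \<Longrightarrow> v \<in> tangent_space S z \<Longrightarrow> pullback_on S \<Phi> \<Omega> z u v = \<Omega> u v"
proof -
  obtain D where D: "(\<Phi> has_derivative D) (at z within S)"
    "\<And>u v. u \<in> tangent_space S z \<Longrightarrow> v \<in> tangent_space S z \<Longrightarrow> \<Omega> (D u) (D v) = \<Omega> u v"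
    using assms unfolding preserves_form_at_def by blast
  then show diff: "\<Phi> differentiable (at z within S)"
    unfolding differentiable_def by blast
  have "frechet_derivative \<Phi> (at z within S) u = D u" if u: "u \<in> tangent_space S z" for u
  proof -
    obtain \<gamma> where \<gamma>: "\<gamma> 0 = z" "\<forall>\<^sub>F t in nhds 0. \<gamma> t \<in> S" "(\<gamma> has_vector_derivative u) (at (0::real))"
      using u unfolding tangent_space_def by blast
    show ?thesis
      using has_vector_derivative_compose_curve[OF D(1) \<gamma>]
        has_vector_derivative_compose_curve[OF diff[unfolded frechet_derivative_works] \<gamma>]
      by (metis vector_derivative_at)
  qed
  then show "u \<in> tangent_space S z \<Longrightarrow> v \<in> tangent_space S z \<Longrightarrow> pullback_on S \<Phi> \<Omega> z u v = \<Omega> u v"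
    by (simp add: pullback_on_def D(2))
qed

text \<open>One step without its final kick. The final kick leaves the position fixed, so
  \<open>fst\<close> of this is already q_{n+1}. Thus the equations decouple: the first multiplier
  solves a nonlinear equation alone, the second a linear one afterwards.\<close>

definition pre_step ::
  "(real^'m \<Rightarrow> real^'k) \<Rightarrow> (real^'m \<Rightarrow> real) \<Rightarrow> real^'m^'m \<Rightarrow> real \<Rightarrow>
   real^'k \<Rightarrow> (real^'m) \<times> (real^'m) \<Rightarrow> (real^'m) \<times> (real^'m)" where
  "pre_step g U L \<epsilon> \<mu> w = flow1 U \<epsilon> (flow2 L \<epsilon> (flow1 U \<epsilon> (constraint_kick g \<epsilon> \<mu> w)))"

lemma step_with_eq: "step_with g U L \<epsilon> m w = constraint_kick g \<epsilon> (snd m) (pre_step g U L \<epsilon> (fst m) w)"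
  by (simp add: step_with_def pre_step_def split_beta)

lemma constraint_kick_eq: "constraint_kick g \<epsilon> \<mu> w = (fst w, snd w - (\<epsilon> / 2) *\<^sub>R (transpose (Jac g (fst w)) *v \<mu>))"
  by (simp add: constraint_kick_def split_beta)

lemma flow1_eq: "flow1 U \<epsilon> w = (fst w, snd w - (\<epsilon> / 2) *\<^sub>R grad U (fst w))"
  by (simp add: flow1_def split_beta)

lemma flow2_eq': "flow2 L \<epsilon> w = (fst w + drift L \<epsilon> *v snd w, rot L \<epsilon> *v snd w)"
  using flow2_eq[of L \<epsilon> "fst w" "snd w"] by simp

text \<open>Besides the variation of \<open>f\<close>, the momentum receives G^T dm and (H dq)^T m.
  The first pairs with the other position variation to zero when that variation lies in the kernel
  of G; the second is symmetric in the two position variations and cancels. The multiplier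
  \<open>m\<close> is a function here because it depends on the initial value.\<close>

lemma Omega_mag_constraint_kick:
  assumes g: "times_diff (Suc (Suc 0)) g"
    and f: "(f has_derivative f') (at x)" and m: "(m has_derivative m') (at x)"
  obtains D where "((\<lambda>x. constraint_kick g \<epsilon> (m x) (f x)) has_derivative D) (at x)"
    and "\<And>u. fst (D u) = fst (f' u)"
    and "\<And>u v. Jac g (fst (f x)) *v fst (f' u) = 0 \<Longrightarrow> Jac g (fst (f x)) *v fst (f' v) = 0 \<Longrightarrow>
      Omega_mag L (D u) (D v) = Omega_mag L (f' u) (f' v)"
proof -
  let ?G = "Jac g (fst (f x))"
  obtain H where H: "((\<lambda>q. Jac g q) has_derivative H) (at (fst (f x)))"
    using C1_differentiable[OF C1_Jac[OF g]] unfolding differentiable_def by blast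
  define D where "D = (\<lambda>u. (fst (f' u), snd (f' u) -
    (\<epsilon> / 2) *\<^sub>R (transpose ?G *v m' u + transpose (H (fst (f' u))) *v m x)))"
  have "((\<lambda>x. transpose (Jac g (fst (f x)))) has_derivative (\<lambda>u. transpose (H (fst (f' u))))) (at x)"
    by (rule bounded_linear.has_derivative[OF bounded_linear_transpose])
      (rule has_derivative_compose[OF has_derivative_fst[OF f] H])
  then have "((\<lambda>x. constraint_kick g \<epsilon> (m x) (f x)) has_derivative D) (at x)"
    unfolding constraint_kick_eq D_def
    by (intro has_derivative_Pair has_derivative_diff has_derivative_fst has_derivative_snd f
        has_derivative_scaleR_right bounded_bilinear.FDERIV[OF bounded_bilinear_matrix_vector] m)
  moreover have "Omega_mag L (D u) (D v) = Omega_mag L (f' u) (f' v)"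
    if u: "?G *v fst (f' u) = 0" and v: "?G *v fst (f' v) = 0" for u v
    using Jac_derivative_symmetric[OF g H, of "fst (f' u)" "fst (f' v)"]
    by (simp add: Omega_mag_eq D_def inner_diff_left inner_diff_right inner_add_left inner_add_right
        inner_transpose_left inner_transpose_right u v inner_commute[of "m x"] del: transpose_matrix_vector)
  moreover have "fst (D u) = fst (f' u)" for u
    by (simp add: D_def)
  ultimately show thesis
    using that by blast
qed

lemma Omega_mag_flow1:
  assumes U: "times_diff (Suc (Suc 0)) U" and f: "(f has_derivative f') (at x)"
  obtains D where "((\<lambda>x. flow1 U \<epsilon> (f x)) has_derivative D) (at x)"
    and "\<And>u. fst (D u) = fst (f' u)"
    and "\<And>u v. Omega_mag L (D u) (D v) = Omega_mag L (f' u) (f' v)"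
proof -
  obtain H where H: "(grad U has_derivative H) (at (fst (f x)))"
    using C1_differentiable[OF C1_grad[OF U]] unfolding differentiable_def by blast
  define D where "D = (\<lambda>u. (fst (f' u), snd (f' u) - (\<epsilon> / 2) *\<^sub>R H (fst (f' u))))"
  have "((\<lambda>x. flow1 U \<epsilon> (f x)) has_derivative D) (at x)"
    unfolding flow1_eq D_def
    by (intro has_derivative_Pair has_derivative_diff has_derivative_fst has_derivative_snd f
        has_derivative_scaleR_right has_derivative_compose[OF has_derivative_fst[OF f] H])
  moreover have "Omega_mag L (D u) (D v) = Omega_mag L (f' u) (f' v)" for u v
    using grad_derivative_symmetric[OF U H, of "fst (f' u)" "fst (f' v)"]
    by (simp add: Omega_mag_eq D_def inner_diff_left inner_diff_right inner_commute)
  moreover have "fst (D u) = fst (f' u)" for u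
    by (simp add: D_def)
  ultimately show thesis
    using that by blast
qed

text \<open>The flow is linear, so it serves as its own derivative. Write u = (a, b), v = (c, d). LA
  + R = 1 merges L A d and R d into d. Skewness turns the product of A b with L c into that of R b -
  b with c, which cancels R b against c. The remaining products of A b with d and of R b with A d
  are equal because A^T = R^T A.\<close>

lemma Omega_mag_flow2:
  assumes L: "transpose L = - L"
  shows "Omega_mag L (flow2 L \<epsilon> u) (flow2 L \<epsilon> v) = Omega_mag L u v"
proof -
  let ?A = "drift L \<epsilon>" and ?R = "rot L \<epsilon>"
  have LA: "L *v (?A *v x) + ?R *v x = x" for x
    using arg_cong[OF rot_drift[of L \<epsilon>], of "\<lambda>X. X *v x"]
    by (simp add: matrix_vector_mult_add_rdistrib matrix_vector_mul_assoc)
  have skew: "a \<bullet> (L *v b) = - (L *v a) \<bullet> b" for a b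
  proof -
    have "a \<bullet> (L *v b) = (transpose L *v a) \<bullet> b"
      by (simp add: inner_transpose_left del: transpose_matrix_vector)
    then show ?thesis
      using bounded_bilinear.minus_left[OF bounded_bilinear_matrix_vector, of L a] by (simp add: L)
  qed
  have A: "(?A *v a) \<bullet> b = (?R *v a) \<bullet> (?A *v b)" for a b
  proof -
    have "(?A *v a) \<bullet> b = a \<bullet> (transpose ?A *v b)"
      by (simp add: inner_transpose_right del: transpose_matrix_vector)
    also have "\<dots> = a \<bullet> (transpose ?R *v (?A *v b))"
      by (simp add: transpose_drift[OF L] matrix_vector_mul_assoc del: transpose_matrix_vector)
    finally show ?thesis
      by (simp add: inner_transpose_right del: transpose_matrix_vector)
  qed
  have LA': "(L *v (?A *v x)) = x - ?R *v x" for x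
    using LA[of x] by (simp add: algebra_simps)
  have "(?A *v a) \<bullet> (L *v b) = (?R *v a) \<bullet> b - a \<bullet> b" for a b
    using skew[of "?A *v a" b] by (simp add: LA' inner_diff_left)
  then show ?thesis
    by (simp add: flow2_eq' Omega_mag_eq inner_add_left inner_add_right matrix_vector_right_distrib
        inner_diff_left inner_diff_right LA' A[symmetric])
qed

subsection \<open>The integrator on the constraint manifold\<close>

lemma cotangent_bundle_iff:
  "w \<in> cotangent_bundle g \<longleftrightarrow> g (fst w) = 0 \<and> Jac g (fst w) *v snd w = 0"
  by (simp add: cotangent_bundle_def split_beta)

lemma C1_constraint_kick:
  assumes "times_diff (Suc (Suc 0)) g" "C1 e" "C1 m" "C1 f"
  shows "C1 (\<lambda>x. constraint_kick g (e x) (m x) (f x))"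
  unfolding constraint_kick_eq
  by (intro C1_Pair C1_diff C1_scaleR C1_linear_compose[OF bounded_linear_divide] C1_matrix_vector C1_transpose
      C1_compose[OF C1_Jac] C1_fst C1_snd assms)

lemma C1_flow1:
  assumes "times_diff (Suc (Suc 0)) U" "C1 e" "C1 f"
  shows "C1 (\<lambda>x. flow1 U (e x) (f x))"
  unfolding flow1_eq
  by (intro C1_Pair C1_diff C1_scaleR C1_linear_compose[OF bounded_linear_divide]
      C1_compose[OF C1_grad] C1_fst C1_snd assms)

lemma C1_flow2:
  assumes "C1 e" "C1 f"
  shows "C1 (\<lambda>x. flow2 L (e x) (f x))"
  unfolding flow2_eq'
  by (intro C1_Pair C1_add C1_matrix_vector C1_compose[OF C1_drift] C1_compose[OF C1_rot] C1_fst C1_snd assms)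

lemma C1_pre_step:
  assumes "times_diff (Suc (Suc 0)) g" "times_diff (Suc (Suc 0)) U" "C1 e" "C1 m" "C1 f"
  shows "C1 (\<lambda>x. pre_step g U L (e x) (m x) (f x))"
  unfolding pre_step_def by (intro C1_flow1 C1_flow2 C1_constraint_kick assms)

lemma C1_step_with:
  assumes "times_diff (Suc (Suc 0)) g" "times_diff (Suc (Suc 0)) U" "C1 e" "C1 m" "C1 f"
  shows "C1 (\<lambda>x. step_with g U L (e x) (m x) (f x))"
  unfolding step_with_eq by (intro C1_constraint_kick C1_pre_step C1_fst C1_snd assms)

lemma fst_step_with: "fst (step_with g U L \<epsilon> m w) = fst (pre_step g U L \<epsilon> (fst m) w)"
  by (simp add: step_with_eq constraint_kick_eq)

text \<open>The five factors are composed. Only the two kicks impose conditions: the first at the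
  old position on \<open>u\<close> and \<open>v\<close>, the last at the new position on their
  images.\<close>

lemma Omega_mag_step_with:
  assumes g: "times_diff (Suc (Suc 0)) g" and U: "times_diff (Suc (Suc 0)) U" and L: "transpose L = - L"
    and m: "m differentiable (at z)"
  obtains D where "((\<lambda>w. step_with g U L \<epsilon> (m w) w) has_derivative D) (at z)"
    and "\<And>u v. \<lbrakk>Jac g (fst z) *v fst u = 0; Jac g (fst z) *v fst v = 0;
        Jac g (fst (step_with g U L \<epsilon> (m z) z)) *v fst (D u) = 0;
        Jac g (fst (step_with g U L \<epsilon> (m z) z)) *v fst (D v) = 0\<rbrakk> \<Longrightarrow>
      Omega_mag L (D u) (D v) = Omega_mag L u v"
proof -
  obtain m' where m': "(m has_derivative m') (at z)"
    using m unfolding differentiable_def by blast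
  obtain D1 where D1: "((\<lambda>w. constraint_kick g \<epsilon> (fst (m w)) w) has_derivative D1) (at z)"
    "\<And>u v. Jac g (fst z) *v fst u = 0 \<Longrightarrow> Jac g (fst z) *v fst v = 0 \<Longrightarrow>
      Omega_mag L (D1 u) (D1 v) = Omega_mag L u v"
    by (rule Omega_mag_constraint_kick[OF g has_derivative_ident has_derivative_fst[OF m'], of \<epsilon> L]) blast
  obtain D2 where D2: "((\<lambda>w. flow1 U \<epsilon> (constraint_kick g \<epsilon> (fst (m w)) w)) has_derivative D2) (at z)"
    "\<And>u v. Omega_mag L (D2 u) (D2 v) = Omega_mag L (D1 u) (D1 v)"
    by (rule Omega_mag_flow1[OF U D1(1), of \<epsilon> L]) blast
  have "bounded_linear (flow2 L \<epsilon>)"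
    unfolding flow2_eq'[abs_def]
    by (intro bounded_linear_Pair bounded_linear_add bounded_linear_fst bounded_linear_snd
        bounded_linear_compose[OF matrix_vector_mul_bounded_linear])
  then have D3: "((\<lambda>w. flow2 L \<epsilon> (flow1 U \<epsilon> (constraint_kick g \<epsilon> (fst (m w)) w))) has_derivative (\<lambda>u. flow2 L \<epsilon> (D2 u))) (at z)"
    using D2(1) by (rule bounded_linear.has_derivative)
  obtain D4 where D4: "((\<lambda>w. pre_step g U L \<epsilon> (fst (m w)) w) has_derivative D4) (at z)"
    "\<And>u v. Omega_mag L (D4 u) (D4 v) = Omega_mag L (D2 u) (D2 v)"
    unfolding pre_step_def by (rule Omega_mag_flow1[OF U D3, of \<epsilon> L]) (simp add: Omega_mag_flow2[OF L])
  obtain D where D: "((\<lambda>w. step_with g U L \<epsilon> (m w) w) has_derivative D) (at z)"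
    "\<And>u. fst (D u) = fst (D4 u)"
    "\<And>u v. Jac g (fst (pre_step g U L \<epsilon> (fst (m z)) z)) *v fst (D4 u) = 0 \<Longrightarrow>
      Jac g (fst (pre_step g U L \<epsilon> (fst (m z)) z)) *v fst (D4 v) = 0 \<Longrightarrow>
      Omega_mag L (D u) (D v) = Omega_mag L (D4 u) (D4 v)"
    unfolding step_with_eq by (rule Omega_mag_constraint_kick[OF g D4(1) has_derivative_snd[OF m'], of \<epsilon> L]) blast
  show thesis
    by (rule that[OF D(1)]) (simp add: D(2,3) D4(2) D2(2) D1(2) fst_step_with)
qed

text \<open>Differentiating g = 0 along a curve in the bundle gives exactly the condition under
  which a kick preserves the form.\<close>

lemma tangent_space_cotangent_bundle:
  assumes g: "times_diff (Suc (Suc 0)) g" and u: "u \<in> tangent_space (cotangent_bundle g) z"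
  shows "Jac g (fst z) *v fst u = 0"
proof -
  obtain \<gamma> where \<gamma>: "\<gamma> 0 = z" "\<forall>\<^sub>F t in nhds 0. \<gamma> t \<in> cotangent_bundle g" "(\<gamma> has_vector_derivative u) (at (0::real))"
    using u unfolding tangent_space_def by blast
  have "((\<lambda>w. g (fst w)) has_derivative (\<lambda>v. Jac g (fst z) *v fst v)) (at z within cotangent_bundle g)"
    by (rule has_derivative_at_withinI)
      (rule has_derivative_compose[OF has_derivative_fst[OF has_derivative_ident] has_derivative_Jac[OF g]])
  from has_vector_derivative_compose_curve[OF this \<gamma>]
  have "((\<lambda>t. g (fst (\<gamma> t))) has_vector_derivative Jac g (fst z) *v fst u) (at 0)" .
  moreover have "((\<lambda>t. g (fst (\<gamma> t))) has_vector_derivative 0) (at 0)"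
  proof -
    obtain T where T: "open T" "0 \<in> T" "\<And>t. t \<in> T \<Longrightarrow> \<gamma> t \<in> cotangent_bundle g"
      using \<gamma>(2) unfolding eventually_nhds by blast
    show ?thesis
      by (rule has_vector_derivative_transform_within_open[OF has_vector_derivative_const[of 0] T(1,2)])
        (use T(3) in \<open>auto simp: cotangent_bundle_iff\<close>)
  qed
  ultimately show ?thesis
    using vector_derivative_unique_at by blast
qed

section \<open>The step selected by uniqueness of the multipliers\<close>

lemma is_multiplier_multipliers:
  assumes "\<exists>!m. is_multiplier g U L B \<epsilon> z m"
  shows "is_multiplier g U L B \<epsilon> z (multipliers g U L B \<epsilon> z)"
  unfolding multipliers_def using assms by (rule theI')

lemma one_step_in_cotangent_bundle:
  assumes "\<exists>!m. is_multiplier g U L B \<epsilon> z m"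
  shows "one_step g U L B \<epsilon> z \<in> cotangent_bundle g"
  using is_multiplier_multipliers[OF assms] by (simp add: one_step_def is_multiplier_def)

lemma one_step_eq_step_with:
  assumes "\<exists>!m. is_multiplier g U L B \<epsilon> z m" "is_multiplier g U L B \<epsilon> z m"
  shows "one_step g U L B \<epsilon> z = step_with g U L \<epsilon> m z"
  using assms is_multiplier_multipliers[OF assms(1)] by (auto simp: one_step_def)

context
  fixes g :: "real^'m \<Rightarrow> real^'k" and U :: "real^'m \<Rightarrow> real" and L :: "real^'m^'m"
  assumes g: "times_diff (Suc (Suc 0)) g" and U: "times_diff (Suc (Suc 0)) U"
    and full_rank: "\<And>q. g q = 0 \<Longrightarrow> rank (Jac g q) = CARD('k)"
    and skew: "transpose L = - L"
begin

text \<open>The derivative of the two constraints in the two multipliers is block triangular,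
  because the new position depends on the first multiplier alone. The position block is invertible
  by regularity; the momentum block is -(\<epsilon>/2) G G^T, invertible by full rank at the new
  position.\<close>

lemma implicit_multipliers:
  assumes c: "step_with g U L \<epsilon> m z \<in> cotangent_bundle g" and reg: "regular_multiplier g U L \<epsilon> z m"
  obtains \<phi> where "\<phi> z = m" "\<phi> differentiable (at z)"
    "\<forall>\<^sub>F w in nhds z. step_with g U L \<epsilon> (\<phi> w) w \<in> cotangent_bundle g"
proof -
  define c where "c = (\<lambda>w. (g (fst w), Jac g (fst w) *v snd w))"
  have in_iff: "w \<in> cotangent_bundle g \<longleftrightarrow> c w = 0" for w
    by (simp add: c_def cotangent_bundle_iff zero_prod_def)
  define F where "F = (\<lambda>x. c (step_with g U L \<epsilon> (snd x) (fst x)))"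
  have C1_c: "C1 c"
    unfolding c_def
    by (intro C1_Pair C1_matrix_vector C1_compose[OF C1_if_times_diff_2[OF g]] C1_compose[OF C1_Jac[OF g]] C1_fst C1_snd C1_id)
  have C1_F: "C1 F"
    unfolding F_def by (intro C1_compose[OF C1_c] C1_step_with g U C1_fst C1_snd C1_id C1_const)
  obtain F' where F': "(F has_derivative F') (at (z, m))"
    using C1_differentiable[OF C1_F] unfolding differentiable_def by blast
  define E where "E = (\<lambda>h. F' (0, h))"
  have E: "((\<lambda>m. F (z, m)) has_derivative E) (at m)"
    unfolding E_def by (rule has_derivative_compose[where f = "\<lambda>m. (z, m)" and g = F, OF _ F']) (auto intro!: derivative_eq_intros)
  have linE: "linear E"
    using E has_derivative_linear by blast
  define y where "y = pre_step g U L \<epsilon> (fst m) z"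
  let ?G = "Jac g (fst y)"
  have "((\<lambda>\<mu>. (\<mu>, snd m)) has_derivative (\<lambda>a. (a, 0))) (at (fst m))"
    by (auto intro!: derivative_eq_intros)
  from has_derivative_fst[OF has_derivative_compose[OF this, of "\<lambda>m. F (z, m)" E]]
  have part1: "((\<lambda>\<mu>. g (fst (step_with g U L \<epsilon> (\<mu>, snd m) z))) has_derivative (\<lambda>a. fst (E (a, 0)))) (at (fst m))"
    using E by (simp add: F_def c_def)
  have inj1: "a = 0" if "fst (E (a, 0)) = 0" for a
  proof -
    have "invertible (matrix (\<lambda>a. fst (E (a, 0))))"
      using reg frechet_derivative_at[OF part1] by (simp add: regular_multiplier_def jacobian_def)
    then obtain B where "B ** matrix (\<lambda>a. fst (E (a, 0))) = mat 1"
      unfolding invertible_def by blast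
    then have "a = B *v (matrix (\<lambda>a. fst (E (a, 0))) *v a)"
      by (simp add: matrix_vector_mul_assoc)
    also have "matrix (\<lambda>a. fst (E (a, 0))) *v a = 0"
      using fun_cong[OF matrix_vector_mul(2)[OF has_derivative_linear[OF part1]], of a] that by simp
    finally show "a = 0"
      by simp
  qed
  \<comment> \<open>Regularity forces this: for step size 0 the position ignores
    \<open>\<mu>\<close>, so the derivative is zero, which is not injective on the nonzero space
    \<open>real^'k\<close>.\<close>
  have "\<epsilon> \<noteq> 0"
  proof
    assume "\<epsilon> = 0"
    then have const: "(\<lambda>\<mu>. g (fst (step_with g U L \<epsilon> (\<mu>, snd m) z))) = (\<lambda>\<mu>. g (fst (step_with g U L \<epsilon> m z)))"
      by (simp add: step_with_eq pre_step_def constraint_kick_eq)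
    have "(\<lambda>a. fst (E (a, 0))) = (\<lambda>a. 0)"
      by (rule has_derivative_unique[OF part1[unfolded const] has_derivative_const])
    then have "axis undefined 1 = (0 :: real^'k)"
      using inj1[of "axis undefined 1"] fun_cong[of "\<lambda>a. fst (E (a, 0))" "\<lambda>a. 0"] by blast
    then show False
      by (simp add: axis_eq_0_iff)
  qed
  have "((\<lambda>\<mu>'. (fst m, \<mu>')) has_derivative (\<lambda>b. (0, b))) (at (snd m))"
    by (auto intro!: derivative_eq_intros)
  from has_derivative_compose[OF this, of "\<lambda>m. F (z, m)" E]
  have "((\<lambda>\<mu>'. F (z, (fst m, \<mu>'))) has_derivative (\<lambda>b. E (0, b))) (at (snd m))"
    using E by simp
  moreover have "(\<lambda>\<mu>'. F (z, (fst m, \<mu>'))) = (\<lambda>\<mu>'. (g (fst y), ?G *v (snd y - (\<epsilon> / 2) *\<^sub>R (transpose ?G *v \<mu>'))))"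
    by (simp add: F_def c_def step_with_eq constraint_kick_eq y_def del: transpose_matrix_vector)
  ultimately have d: "((\<lambda>\<mu>'. (g (fst y), ?G *v (snd y - (\<epsilon> / 2) *\<^sub>R (transpose ?G *v \<mu>')))) has_derivative (\<lambda>b. E (0, b))) (at (snd m))"
    by (simp only:)
  have "((\<lambda>\<mu>'. (g (fst y), ?G *v (snd y - (\<epsilon> / 2) *\<^sub>R (transpose ?G *v \<mu>')))) has_derivative
      (\<lambda>b. (0, ?G *v (0 - (\<epsilon> / 2) *\<^sub>R (transpose ?G *v b))))) (at (snd m))"
    by (intro has_derivative_Pair has_derivative_const has_derivative_diff has_derivative_scaleR_right has_derivative_ident
        bounded_linear.has_derivative[OF matrix_vector_mul_bounded_linear])
  from fun_cong[OF has_derivative_unique[OF d this]]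
  have part2: "E (0, b) = (0, ?G *v (0 - (\<epsilon> / 2) *\<^sub>R (transpose ?G *v b)))" for b .
  have inj: "v = 0" if "E v = 0" for v
  proof -
    obtain a b where v: "v = (a, b)" by (cases v)
    have split: "E v = E (a, 0) + E (0, b)"
      using linear_add[OF linE, of "(a, 0)" "(0, b)"] by (simp add: v)
    have "fst (E (a, 0)) = fst (E v)"
      unfolding split part2 by simp
    then have "a = 0"
      by (rule inj1[OF trans]) (simp add: that)
    then have "E (0, b) = 0"
      using that v by simp
    then have "?G *v (- (\<epsilon> / 2) *\<^sub>R (transpose ?G *v b)) = 0"
      by (simp add: part2 zero_prod_def del: transpose_matrix_vector)
    then have "?G *v (transpose ?G *v b) = 0"
      using \<open>\<epsilon> \<noteq> 0\<close> by (simp add: matrix_vector_mult_scaleR bounded_bilinear.minus_right[OF bounded_bilinear_matrix_vector]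
          del: transpose_matrix_vector)
    \<comment> \<open>Pairing G G^T b = 0 with b gives the squared norm of G^T b; full rank then
      gives b = 0.\<close>
    then have "(transpose ?G *v b) \<bullet> (transpose ?G *v b) = 0"
      using inner_transpose_left[of ?G b "transpose ?G *v b"] by simp
    then have "transpose ?G *v b = 0"
      by simp
    moreover have "g (fst y) = 0"
      using c by (simp add: cotangent_bundle_iff fst_step_with y_def)
    ultimately have "b = 0"
      using transpose_full_rank_eq_0[OF full_rank] by blast
    with \<open>a = 0\<close> v show "v = 0" by (simp add: zero_prod_def)
  qed
  have "F (z, m) = 0"
    using c in_iff by (simp add: F_def)
  from C1_implicit_function[OF C1_F this E inj]
  obtain \<phi> where "\<phi> z = m" "\<phi> differentiable (at z)" "\<forall>\<^sub>F w in nhds z. F (w, \<phi> w) = 0"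
    by blast
  then show thesis
    by (intro that[of \<phi>]) (simp_all add: F_def in_iff)
qed

text \<open>Openness of \<open>B\<close> keeps the implicit multipliers \<open>\<phi> w\<close> in
  \<open>B \<times> B\<close> for \<open>w\<close> near \<open>z\<close>. There uniqueness
  identifies them with the chosen ones, so on the bundle the step equals a map differentiable at
  \<open>z\<close>. As that map sends curves in the bundle to curves in the bundle, images of
  tangent vectors satisfy the condition at the new position.\<close>

lemma one_step_preserves_form:
  assumes B: "open B" and z: "z \<in> cotangent_bundle g" and small: "small_enough_at g U L B \<epsilon> z"
  shows "preserves_form_at (cotangent_bundle g) (Omega_mag L) (one_step g U L B \<epsilon>) z"
proof -
  let ?S = "cotangent_bundle g"
  have ex1: "\<forall>\<^sub>F w in nhds z. w \<in> ?S \<longrightarrow> (\<exists>!m. is_multiplier g U L B \<epsilon> w m)"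
    and reg: "regular_multiplier g U L \<epsilon> z (multipliers g U L B \<epsilon> z)"
    using small by (auto simp: small_enough_at_def)
  have m: "is_multiplier g U L B \<epsilon> z (multipliers g U L B \<epsilon> z)"
    using is_multiplier_multipliers eventually_nhds_x_imp_x[OF ex1] z by blast
  then obtain \<phi> where \<phi>: "\<phi> z = multipliers g U L B \<epsilon> z" "\<phi> differentiable (at z)"
    "\<forall>\<^sub>F w in nhds z. step_with g U L \<epsilon> (\<phi> w) w \<in> ?S"
    using implicit_multipliers[OF _ reg] by (auto simp: is_multiplier_def)
  have "(\<phi> \<longlongrightarrow> \<phi> z) (nhds z)"
    using differentiable_imp_continuous_within[OF \<phi>(2)] tendsto_at_iff_tendsto_nhds[of \<phi> z] by (simp add: isCont_def)
  moreover have "open (B \<times> B)" "\<phi> z \<in> B \<times> B"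
    using B m \<phi>(1) by (auto simp: is_multiplier_def intro: open_Times)
  ultimately have "\<forall>\<^sub>F w in nhds z. \<phi> w \<in> B \<times> B"
    by (rule topological_tendstoD)
  with ex1 \<phi>(3) have eq: "\<forall>\<^sub>F w in nhds z. w \<in> ?S \<longrightarrow>
      one_step g U L B \<epsilon> w = step_with g U L \<epsilon> (\<phi> w) w \<and> step_with g U L \<epsilon> (\<phi> w) w \<in> ?S"
  proof eventually_elim
    case (elim w)
    then show ?case
      using one_step_eq_step_with[of g U L B \<epsilon> w "\<phi> w"] by (simp add: is_multiplier_def)
  qed
  obtain D where D: "((\<lambda>w. step_with g U L \<epsilon> (\<phi> w) w) has_derivative D) (at z)"
    "\<And>u v. \<lbrakk>Jac g (fst z) *v fst u = 0; Jac g (fst z) *v fst v = 0;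
        Jac g (fst (step_with g U L \<epsilon> (\<phi> z) z)) *v fst (D u) = 0;
        Jac g (fst (step_with g U L \<epsilon> (\<phi> z) z)) *v fst (D v) = 0\<rbrakk> \<Longrightarrow>
      Omega_mag L (D u) (D v) = Omega_mag L u v"
    by (rule Omega_mag_step_with[OF g U skew \<phi>(2), of \<epsilon>]) blast
  have D': "((\<lambda>w. step_with g U L \<epsilon> (\<phi> w) w) has_derivative D) (at z within ?S)"
    by (rule has_derivative_at_withinI[OF D(1)])
  have tan: "Jac g (fst (step_with g U L \<epsilon> (\<phi> z) z)) *v fst (D u) = 0" if "u \<in> tangent_space ?S z" for u
  proof (rule tangent_space_cotangent_bundle[OF g], rule tangent_space_image[OF D' _ that])
    show "\<forall>\<^sub>F w in nhds z. w \<in> ?S \<longrightarrow> step_with g U L \<epsilon> (\<phi> w) w \<in> ?S"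
      using \<phi>(3) by eventually_elim simp
  qed
  have "(one_step g U L B \<epsilon> has_derivative D) (at z within ?S)"
  proof (rule has_derivative_transform_eventually[OF D'])
    show "\<forall>\<^sub>F w in at z within ?S. step_with g U L \<epsilon> (\<phi> w) w = one_step g U L B \<epsilon> w"
      unfolding eventually_at_filter using eq by eventually_elim simp
    show "step_with g U L \<epsilon> (\<phi> z) z = one_step g U L B \<epsilon> z"
      using eventually_nhds_x_imp_x[OF eq] z by simp
  qed (rule z)
  moreover have "\<forall>\<^sub>F w in nhds z. w \<in> ?S \<longrightarrow> one_step g U L B \<epsilon> w \<in> ?S"
    using eq by eventually_elim auto
  moreover have "Omega_mag L (D u) (D v) = Omega_mag L u v"
    if "u \<in> tangent_space ?S z" "v \<in> tangent_space ?S z" for u v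
    using that by (intro D(2) tan tangent_space_cotangent_bundle[OF g])
  ultimately show ?thesis
    unfolding preserves_form_at_def by blast
qed

lemma integrator_preserves_form:
  assumes B: "open B" and z: "z \<in> cotangent_bundle g"
    and small: "\<forall>n\<le>N. small_enough_at g U L B \<epsilon> (integrator g U L B \<epsilon> n z)"
  shows "integrator g U L B \<epsilon> N z \<in> cotangent_bundle g \<and>
    preserves_form_at (cotangent_bundle g) (Omega_mag L) (integrator g U L B \<epsilon> N) z"
  using small
proof (induction N)
  case 0
  then show ?case
    using z preserves_form_at_id[of "cotangent_bundle g" "Omega_mag L" z] by (simp add: integrator_def id_def)
next
  case (Suc N)
  then have IH: "integrator g U L B \<epsilon> N z \<in> cotangent_bundle g"
    "preserves_form_at (cotangent_bundle g) (Omega_mag L) (integrator g U L B \<epsilon> N) z"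
    by auto
  have eq: "integrator g U L B \<epsilon> (Suc N) = (\<lambda>z. one_step g U L B \<epsilon> (integrator g U L B \<epsilon> N z))"
    by (simp add: integrator_def fun_eq_iff)
  have step: "preserves_form_at (cotangent_bundle g) (Omega_mag L) (one_step g U L B \<epsilon>) (integrator g U L B \<epsilon> N z)"
    using Suc.prems by (intro one_step_preserves_form B IH(1)) simp
  then have "one_step g U L B \<epsilon> (integrator g U L B \<epsilon> N z) \<in> cotangent_bundle g"
    using IH(1) eventually_nhds_x_imp_x unfolding preserves_form_at_def by fastforce
  with preserves_form_at_compose[OF IH(2) step] show ?case
    unfolding eq by blast
qed

section \<open>Time reversal\<close>

lemma flow2_inverse: "flow2 L \<epsilon> (flow2 L (- \<epsilon>) w) = w"
proof -
  have "rot L \<epsilon> ** transpose (rot L \<epsilon>) = mat 1"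
    using transpose_rot_rot[OF skew] matrix_left_right_inverse by blast
  \<comment> \<open>Transposing A^T = R^T A gives A = A^T R, hence A R^T = A^T. As R(-\<epsilon>) =
    R^T and A(-\<epsilon>) = -A^T, the two displacements cancel.\<close>
  then have "drift L \<epsilon> ** transpose (rot L \<epsilon>) = transpose (drift L \<epsilon>)"
    using arg_cong[OF transpose_drift[OF skew, of \<epsilon>], of "\<lambda>X. transpose X ** transpose (rot L \<epsilon>)"]
    by (simp add: matrix_transpose_mul matrix_mul_assoc[symmetric])
  then have "drift L \<epsilon> ** rot L (- \<epsilon>) + drift L (- \<epsilon>) = 0"
    by (simp add: rot_uminus_eq_transpose[OF skew] drift_uminus[OF skew])
  then have "drift L \<epsilon> *v (rot L (- \<epsilon>) *v p) + drift L (- \<epsilon>) *v p = 0" for p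
    by (metis matrix_vector_mul_assoc matrix_vector_mult_add_rdistrib matrix_vector_mult_0)
  moreover have "rot L \<epsilon> *v (rot L (- \<epsilon>) *v p) = p" for p
    using rot_uminus[of L "- \<epsilon>"] by (simp add: matrix_vector_mul_assoc)
  ultimately show ?thesis
    by (simp add: flow2_eq' add.assoc add.commute prod_eq_iff)
qed

text \<open>The five factors form a palindrome once the multipliers are exchanged, and each factor
  is inverted by changing the sign of the step size. For the kicks this holds because they leave
  fixed the position at which G is taken.\<close>

lemma step_with_inverse:
  "step_with g U L \<epsilon> (snd m, fst m) (step_with g U L (- \<epsilon>) m w) = w"
proof -
  have "constraint_kick g \<epsilon> \<mu> (constraint_kick g (- \<epsilon>) \<mu> w) = w" for \<mu> w
    by (simp add: constraint_kick_eq)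
  moreover have "flow1 U \<epsilon> (flow1 U (- \<epsilon>) w) = w" for w
    by (simp add: flow1_eq)
  ultimately show ?thesis
    by (simp add: step_with_eq pre_step_def flow2_inverse)
qed

text \<open>Both multipliers are sought in the same set \<open>B\<close>, so the exchanged pair is
  again admissible, and uniqueness at the image point selects it.\<close>

lemma one_step_inverse:
  assumes z: "\<exists>!m. is_multiplier g U L B (- \<epsilon>) z m" "z \<in> cotangent_bundle g"
    and z': "\<exists>!m. is_multiplier g U L B \<epsilon> (one_step g U L B (- \<epsilon>) z) m"
  shows "one_step g U L B \<epsilon> (one_step g U L B (- \<epsilon>) z) = z"
proof -
  let ?m = "multipliers g U L B (- \<epsilon>) z"
  have inv: "step_with g U L \<epsilon> (snd ?m, fst ?m) (one_step g U L B (- \<epsilon>) z) = z"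
    by (simp add: one_step_def step_with_inverse)
  have "is_multiplier g U L B \<epsilon> (one_step g U L B (- \<epsilon>) z) (snd ?m, fst ?m)"
    using is_multiplier_multipliers[OF z(1)] z(2) by (auto simp: is_multiplier_def inv)
  then show ?thesis
    using one_step_eq_step_with[OF z'] inv by simp
qed

lemma integrator_inverse:
  assumes z: "z \<in> cotangent_bundle g"
    and small: "\<forall>n\<le>N. small_enough_at g U L B (- \<epsilon>) (integrator g U L B (- \<epsilon>) n z)"
  shows "integrator g U L B (- \<epsilon>) N z \<in> cotangent_bundle g \<and>
    integrator g U L B \<epsilon> N (integrator g U L B (- \<epsilon>) N z) = z"
  using small
proof (induction N)
  case 0
  then show ?case using z by (simp add: integrator_def)
next
  case (Suc N)
  let ?z = "integrator g U L B (- \<epsilon>) N z"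
  have IH: "?z \<in> cotangent_bundle g" "integrator g U L B \<epsilon> N ?z = z"
    using Suc by auto
  have eq: "integrator g U L B (- \<epsilon>) (Suc N) z = one_step g U L B (- \<epsilon>) ?z"
    by (simp add: integrator_def)
  have small: "\<exists>!m. is_multiplier g U L B e w m"
    if "small_enough_at g U L B (- \<epsilon>) w" "w \<in> cotangent_bundle g" "e \<in> {\<epsilon>, - \<epsilon>}" for w e
    using that eventually_nhds_x_imp_x unfolding small_enough_at_def by fastforce
  have 1: "\<exists>!m. is_multiplier g U L B (- \<epsilon>) ?z m"
    using Suc.prems IH(1) by (intro small) auto
  have in_S: "one_step g U L B (- \<epsilon>) ?z \<in> cotangent_bundle g"
    by (rule one_step_in_cotangent_bundle[OF 1])
  have 2: "\<exists>!m. is_multiplier g U L B \<epsilon> (one_step g U L B (- \<epsilon>) ?z) m"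
    using Suc.prems in_S eq by (intro small) (metis order_refl, auto)
  \<comment> \<open>The first of the steps of size \<open>\<epsilon>\<close> undoes the last of
    those of size \<open>- \<epsilon>\<close>; \<open>funpow_swap1\<close> brings that first step
    next to its argument.\<close>
  have "integrator g U L B \<epsilon> (Suc N) (one_step g U L B (- \<epsilon>) ?z) = integrator g U L B \<epsilon> N ?z"
    using one_step_inverse[OF 1 IH(1) 2] by (simp add: integrator_def funpow_swap1)
  then show ?case
    using IH in_S eq by simp
qed

end

subsection \<open>Existence of the multipliers\<close>

text \<open>Without a zero, the field normalised to length \<open>r\<close> maps the ball into its
  boundary sphere. A Brouwer fixed point would lie on the sphere with the field pointing outward
  there.\<close>

lemma vector_field_has_zero:
  fixes f :: "'a::euclidean_space \<Rightarrow> 'a"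
  assumes r: "0 < r" and f: "continuous_on (cball 0 r) f"
    and inward: "\<And>x. norm x = r \<Longrightarrow> x \<bullet> f x \<le> 0"
  obtains x where "x \<in> cball 0 r" "f x = 0"
proof (rule ccontr)
  assume "\<not> thesis"
  then have nz: "f x \<noteq> 0" if "x \<in> cball 0 r" for x
    using that \<open>\<And>x. \<lbrakk>x \<in> cball 0 r; f x = 0\<rbrakk> \<Longrightarrow> thesis\<close> by blast
  define F where "F = (\<lambda>x. (r / norm (f x)) *\<^sub>R f x)"
  have cont: "continuous_on (cball 0 r) F"
    unfolding F_def by (intro continuous_intros f) (use nz in auto)
  have norm_F: "norm (F x) = r" if "x \<in> cball 0 r" for x
    using nz[OF that] r by (simp add: F_def)
  then have "F \<in> cball 0 r \<rightarrow> cball 0 r"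
    by (simp add: Pi_def)
  then obtain x where x: "x \<in> cball 0 r" "F x = x"
    by (rule brouwer_ball[OF r cont])
  then have norm_x: "norm x = r"
    using norm_F[of x] by simp
  have "x \<bullet> F x = (r / norm (f x)) * (x \<bullet> f x)"
    by (simp add: F_def)
  also have "\<dots> \<le> 0"
    using inward[OF norm_x] r by (intro mult_nonneg_nonpos) auto
  finally have "x \<bullet> x \<le> 0"
    using x(2) by simp
  then show False
    using norm_x r by (simp add: power2_norm_eq_inner[symmetric])
qed

lemma compact_lower_bound_persists:
  fixes f :: "real \<times> 'a::euclidean_space \<Rightarrow> real"
  assumes f: "continuous_on UNIV f" and K: "compact K" and c: "\<And>x. x \<in> K \<Longrightarrow> c \<le> f (0, x)" "0 < c"
  shows "\<exists>t0>0. \<forall>t x. \<bar>t\<bar> < t0 \<longrightarrow> x \<in> K \<longrightarrow> c / 2 \<le> f (t, x)"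
proof -
  have "uniformly_continuous_on ({-1..1} \<times> K) f"
    by (intro compact_uniformly_continuous compact_Times K continuous_on_subset[OF f]) auto
  then obtain d where d: "d > 0" "\<And>x y. x \<in> {-1..1} \<times> K \<Longrightarrow> y \<in> {-1..1} \<times> K \<Longrightarrow> dist y x < d \<Longrightarrow> dist (f y) (f x) < c / 2"
    unfolding uniformly_continuous_on_def using half_gt_zero[OF c(2)] by metis
  show ?thesis
  proof (intro exI[of _ "min 1 d"] conjI allI impI)
    fix t x assume tx: "\<bar>t\<bar> < min 1 d" "x \<in> K"
    have "dist (f (t, x)) (f (0, x)) < c / 2"
      using tx by (intro d(2)) (auto simp: dist_prod_def)
    then show "c / 2 \<le> f (t, x)"
      using c(1)[OF tx(2)] unfolding dist_real_def by linarith
  qed (use d(1) in simp)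
qed

text \<open>The matrix A/t, completed at 0 by the derivative of \<open>drift\<close>. Since it is
  continuous, the factor t^2 can be taken out of the constraint derivative and the rest compared
  with its value at t = 0.\<close>

definition drift_quotient :: "real^'m^'m \<Rightarrow> real \<Rightarrow> real^'m^'m" where
  "drift_quotient L t = (if t = 0 then mat 1 else (1 / t) *\<^sub>R drift L t)"

lemma drift_eq_quotient: "drift L t = t *\<^sub>R drift_quotient L t"
  by (simp add: drift_quotient_def drift_0)

lemma continuous_on_drift_quotient: "continuous_on S (drift_quotient L)"
proof -
  have "isCont (drift_quotient L) t" for t
  proof (cases "t = 0")
    case True
    have "((\<lambda>h. norm (drift L h - h *\<^sub>R mat 1) / norm h) \<longlongrightarrow> 0) (at 0)"
      using has_vector_derivative_drift[of L 0]
      by (simp add: has_vector_derivative_def has_derivative_at rot_0 drift_0)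
    moreover have "\<forall>\<^sub>F h in at 0. norm (drift L h - h *\<^sub>R mat 1) / norm h = norm ((1 / h) *\<^sub>R drift L h - mat 1)"
    proof (rule eventually_at_filter[THEN iffD2], intro always_eventually allI impI)
      fix h :: real assume "h \<noteq> 0"
      then have "(1 / h) *\<^sub>R drift L h - mat 1 = (1 / h) *\<^sub>R (drift L h - h *\<^sub>R mat 1)"
        by (simp add: scaleR_diff_right)
      then show "norm (drift L h - h *\<^sub>R mat 1) / norm h = norm ((1 / h) *\<^sub>R drift L h - mat 1)"
        by simp
    qed
    ultimately have "((\<lambda>h. norm ((1 / h) *\<^sub>R drift L h - mat 1)) \<longlongrightarrow> 0) (at 0)"
      by (rule Lim_transform_eventually)
    then have "((\<lambda>h. (1 / h) *\<^sub>R drift L h - mat 1) \<longlongrightarrow> 0) (at 0)"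
      by (rule tendsto_norm_zero_cancel)
    then have "((\<lambda>h. (1 / h) *\<^sub>R drift L h) \<longlongrightarrow> mat 1) (at 0)"
      by (rule LIM_zero_cancel)
    moreover have "\<forall>\<^sub>F h in at 0. (1 / h) *\<^sub>R drift L h = drift_quotient L h"
      unfolding eventually_at_filter by (intro always_eventually) (simp add: drift_quotient_def)
    ultimately have "(drift_quotient L \<longlongrightarrow> mat 1) (at 0)"
      by (rule Lim_transform_eventually)
    moreover have "drift_quotient L 0 = mat 1"
      by (simp add: drift_quotient_def)
    ultimately show ?thesis
      unfolding isCont_def True by simp
  next
    case False
    have ev: "\<forall>\<^sub>F s in nhds t. (1 / s) *\<^sub>R drift L s = drift_quotient L s"
      using t1_space_nhds[OF False] by (rule eventually_mono) (simp add: drift_quotient_def)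
    have "isCont (drift L) t"
      by (rule has_vector_derivative_continuous[OF has_vector_derivative_drift])
    then have "isCont (\<lambda>t. (1 / t) *\<^sub>R drift L t) t"
      using False by (intro isCont_scaleR isCont_divide continuous_const continuous_ident)
    then show ?thesis
      by (rule isCont_cong[OF ev, THEN iffD1])
  qed
  then show ?thesis
    by (intro continuous_at_imp_continuous_on) simp
qed

lemma pre_step_eq:
  "pre_step g U L t \<mu> w =
    (let p = snd w - (t / 2) *\<^sub>R (transpose (Jac g (fst w)) *v \<mu>) - (t / 2) *\<^sub>R grad U (fst w);
         q = fst w + drift L t *v p
     in (q, rot L t *v p - (t / 2) *\<^sub>R grad U q))"
  by (simp add: pre_step_def constraint_kick_eq flow1_eq flow2_eq' Let_def)

lemma pre_step_0: "pre_step g U L 0 \<mu> w = w"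
  by (simp add: pre_step_eq drift_0 rot_0)

lemma step_with_0: "step_with g U L 0 m w = w"
  by (simp add: step_with_eq pre_step_0 constraint_kick_eq)

lemma closed_cotangent_bundle:
  fixes g :: "real^'m \<Rightarrow> real^'k"
  assumes g: "times_diff (Suc (Suc 0)) g" shows "closed (cotangent_bundle g)"
proof -
  have "cotangent_bundle g = {w. g (fst w) = 0} \<inter> {w. Jac g (fst w) *v snd w = 0}"
    by (auto simp: cotangent_bundle_iff)
  moreover have "closed {w :: (real^'m) \<times> (real^'m). g (fst w) = 0}"
    by (rule closed_Collect_eq[OF C1_continuous_on continuous_on_const])
      (intro C1_fst C1_id C1_compose[OF C1_if_times_diff_2[OF g]])
  moreover have "closed {w. Jac g (fst w) *v snd w = 0}"
    by (rule closed_Collect_eq[OF C1_continuous_on continuous_on_const])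
      (intro C1_matrix_vector C1_fst C1_snd C1_id C1_compose[OF C1_Jac[OF g]])
  ultimately show ?thesis by auto
qed

section \<open>Estimates uniform over compact sets of initial values\<close>

context
  fixes g :: "real^'m \<Rightarrow> real^'k" and U :: "real^'m \<Rightarrow> real" and L :: "real^'m^'m"
  assumes g: "times_diff (Suc (Suc 0)) g" and U: "times_diff (Suc (Suc 0)) U"
    and full_rank: "\<And>q. g q = 0 \<Longrightarrow> rank (Jac g q) = CARD('k)"
begin

text \<open>The constant is the minimum over \<open>C\<close> times the unit sphere, positive by
  full rank; homogeneity extends the bound to all \<open>d\<close>.\<close>

lemma transpose_Jac_lower_bound:
  assumes C: "compact C" and M: "\<And>q. q \<in> C \<Longrightarrow> g q = 0"
  shows "\<exists>c>0. \<forall>q\<in>C. \<forall>d. c * (norm d)\<^sup>2 \<le> (norm (transpose (Jac g q) *v d))\<^sup>2"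
proof (cases "C = {}")
  case True
  then show ?thesis by (intro exI[of _ 1]) simp
next
  case False
  let ?f = "\<lambda>x. (norm (transpose (Jac g (fst x)) *v snd x))\<^sup>2"
  have "continuous_on (C \<times> sphere 0 1) ?f"
    by (intro continuous_on_power continuous_on_norm C1_continuous_on C1_matrix_vector C1_transpose
        C1_compose[OF C1_Jac[OF g]] C1_fst C1_snd C1_id)
  moreover have "compact (C \<times> sphere (0::real^'k) 1)"
    by (intro compact_Times C compact_sphere)
  moreover have "axis undefined 1 \<in> sphere (0::real^'k) 1"
    by simp
  then have "C \<times> sphere (0::real^'k) 1 \<noteq> {}"
    using False by blast
  ultimately obtain x where x: "x \<in> C \<times> sphere 0 1" "\<And>y. y \<in> C \<times> sphere 0 1 \<Longrightarrow> ?f x \<le> ?f y"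
    using continuous_attains_inf[of "C \<times> sphere 0 1" ?f] by blast
  show ?thesis
  proof (intro exI[of _ "?f x"] conjI ballI allI)
    have "snd x \<noteq> 0" "g (fst x) = 0"
      using x(1) M by auto
    then have "transpose (Jac g (fst x)) *v snd x \<noteq> 0"
      using transpose_full_rank_eq_0[OF full_rank] by blast
    then show "0 < ?f x"
      by simp
  next
    fix q and d :: "real^'k" assume q: "q \<in> C"
    show "?f x * (norm d)\<^sup>2 \<le> (norm (transpose (Jac g q) *v d))\<^sup>2"
    proof (cases "d = 0")
      case False
      define e where "e = d /\<^sub>R norm d"
      have d: "norm d *\<^sub>R e = d"
        using False by (simp add: e_def)
      have "?f x \<le> ?f (q, e)"
        using q False by (intro x(2)) (simp add: e_def)
      moreover have "norm (transpose (Jac g q) *v d) = norm d * norm (transpose (Jac g q) *v e)"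
        using arg_cong[OF d, of "\<lambda>d. norm (transpose (Jac g q) *v d)"]
        by (simp add: matrix_vector_mult_scaleR del: transpose_matrix_vector)
      ultimately show ?thesis
        by (simp add: power_mult_distrib mult.commute mult_left_mono del: transpose_matrix_vector)
    qed simp
  qed
qed

abbreviation "Q t \<mu> w \<equiv> fst (pre_step g U L t \<mu> w)"

text \<open>The position is affine in \<open>\<mu>\<close>: the kick contributes a factor t/2 and
  the drift a factor t, whence t^2/2.\<close>

lemma has_derivative_constraint_in_multiplier:
  "((\<lambda>\<mu>. g (Q t \<mu> w)) has_derivative
    (\<lambda>a. - (t\<^sup>2 / 2) *\<^sub>R (Jac g (Q t \<mu> w) *v (drift_quotient L t *v (transpose (Jac g (fst w)) *v a))))) (at \<mu>)"
proof -
  define p where "p = snd w - (t / 2) *\<^sub>R grad U (fst w)"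
  have Q_eq: "Q t \<mu> w = fst w + drift L t *v (p - (t / 2) *\<^sub>R (transpose (Jac g (fst w)) *v \<mu>))" for \<mu>
    by (simp add: pre_step_eq Let_def p_def algebra_simps)
  have "((\<lambda>\<mu>. Q t \<mu> w) has_derivative (\<lambda>a. 0 + drift L t *v (0 - (t / 2) *\<^sub>R (transpose (Jac g (fst w)) *v a)))) (at \<mu>)"
    unfolding Q_eq
    by (intro has_derivative_add has_derivative_const has_derivative_diff has_derivative_scaleR_right has_derivative_ident
        bounded_linear.has_derivative[OF matrix_vector_mul_bounded_linear])
  from has_derivative_compose[OF this has_derivative_Jac[OF g]]
  show ?thesis
    by (rule has_derivative_eq_rhs)
      (simp add: fun_eq_iff drift_eq_quotient[of L t] matrix_vector_mult_scaleR power2_eq_square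
        scaleR_matrix_vector_assoc[symmetric] bounded_bilinear.minus_right[OF bounded_bilinear_matrix_vector]
        del: transpose_matrix_vector)
qed

lemma C1_Q: "C1 e \<Longrightarrow> C1 m \<Longrightarrow> C1 f \<Longrightarrow> C1 (\<lambda>x. Q (e x) (m x) (f x))"
  by (intro C1_fst C1_pre_step g U)

text \<open>At t = 0 the quadratic form is the squared norm of G^T d, whatever \<open>\<mu>\<close>
  is; compactness preserves half of its lower bound for small t. The order of quantifiers matters:
  \<open>c\<close> precedes \<open>R\<close>, so radii for the multipliers can later be computed
  from \<open>c\<close>.\<close>

lemma constraint_derivative_lower_bound:
  assumes K: "compact K" and M: "\<And>w. w \<in> K \<Longrightarrow> g (fst w) = 0"
  shows "\<exists>c>0. \<forall>R. \<exists>t0>0. \<forall>t w \<mu> d. \<bar>t\<bar> < t0 \<longrightarrow> w \<in> K \<longrightarrow> norm \<mu> \<le> R \<longrightarrow>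
    c * (norm d)\<^sup>2 \<le> d \<bullet> (Jac g (Q t \<mu> w) *v (drift_quotient L t *v (transpose (Jac g (fst w)) *v d)))"
proof -
  have "compact (fst ` K)"
    by (intro compact_continuous_image continuous_on_fst continuous_on_id K)
  moreover have "g q = 0" if "q \<in> fst ` K" for q
    using that M by auto
  ultimately obtain c where c: "0 < c"
    "\<forall>q\<in>fst ` K. \<forall>d. c * (norm d)\<^sup>2 \<le> (norm (transpose (Jac g q) *v d))\<^sup>2"
    using transpose_Jac_lower_bound[of "fst ` K"] by blast
  define f where "f = (\<lambda>(t, (\<mu>, w), d).
     d \<bullet> (Jac g (Q t \<mu> w) *v (drift_quotient L t *v (transpose (Jac g (fst w)) *v d))))"
  have "C1 (\<lambda>x :: real \<times> ((real^'k) \<times> (real^'m) \<times> (real^'m)) \<times> (real^'k).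
      transpose (Jac g (fst (snd (fst (snd x))))) *v snd (snd x))"
    by (intro C1_matrix_vector C1_transpose C1_compose[OF C1_Jac[OF g]] C1_fst C1_snd C1_id)
  note 1 = C1_continuous_on[OF this, of UNIV]
  have "C1 (\<lambda>x :: real \<times> ((real^'k) \<times> (real^'m) \<times> (real^'m)) \<times> (real^'k).
      Jac g (Q (fst x) (fst (fst (snd x))) (snd (fst (snd x)))))"
    by (intro C1_compose[OF C1_Jac[OF g]] C1_Q) (intro C1_fst C1_snd C1_id)+
  note 2 = C1_continuous_on[OF this, of UNIV]
  have 3: "continuous_on UNIV (\<lambda>x :: real \<times> ((real^'k) \<times> (real^'m) \<times> (real^'m)) \<times> (real^'k). drift_quotient L (fst x))"
    by (rule continuous_on_compose2[OF continuous_on_drift_quotient[of UNIV] continuous_on_fst[OF continuous_on_id]]) simp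
  have f: "continuous_on UNIV f"
    unfolding f_def split_beta
    by (intro continuous_on_inner bounded_bilinear.continuous_on[OF bounded_bilinear_matrix_vector] 1 2 3
        continuous_on_snd continuous_on_id)
  have at_0: "c \<le> f (0, (\<mu>, w), d)" if "w \<in> K" "norm d = 1" for \<mu> w d
    using c(2)[rule_format, OF imageI[OF that(1)], of d] that(2) inner_transpose_left[of "Jac g (fst w)" d "transpose (Jac g (fst w)) *v d"]
    by (simp add: f_def pre_step_0 drift_quotient_def power2_norm_eq_inner del: transpose_matrix_vector)
  show ?thesis
  proof (rule exI[of _ "c / 2"], intro conjI allI)
    fix R
    have "compact ((cball (0::real^'k) R \<times> K) \<times> sphere (0::real^'k) 1)"
      by (intro compact_Times K compact_cball compact_sphere)
    moreover have "c \<le> f (0, x)" if "x \<in> (cball 0 R \<times> K) \<times> sphere 0 1" for x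
      using that at_0[of "snd (fst x)" "snd x" "fst (fst x)"] by (auto simp: mem_Times_iff)
    ultimately obtain t0 where t0: "0 < t0"
      "\<forall>t x. \<bar>t\<bar> < t0 \<longrightarrow> x \<in> (cball 0 R \<times> K) \<times> sphere 0 1 \<longrightarrow> c / 2 \<le> f (t, x)"
      using compact_lower_bound_persists[OF f _ _ c(1)] by blast
    have "c / 2 * (norm d)\<^sup>2 \<le> f (t, (\<mu>, w), d)" if "\<bar>t\<bar> < t0" "w \<in> K" "norm \<mu> \<le> R" for t w \<mu> d
    proof (cases "d = 0")
      case False
      define e where "e = d /\<^sub>R norm d"
      have d: "norm d *\<^sub>R e = d"
        using False by (simp add: e_def)
      have le: "c / 2 \<le> f (t, (\<mu>, w), e)"
        using that False by (intro t0(2)[rule_format]) (simp_all add: e_def)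
      have "f (t, (\<mu>, w), r *\<^sub>R e) = r\<^sup>2 * f (t, (\<mu>, w), e)" for r
        by (simp only: f_def prod.case matrix_vector_mult_scaleR inner_scaleR_left inner_scaleR_right power2_eq_square mult.assoc)
      from this[of "norm d"] have eq: "f (t, (\<mu>, w), d) = (norm d)\<^sup>2 * f (t, (\<mu>, w), e)"
        unfolding d .
      show ?thesis
        unfolding eq mult.commute[of "(norm d)\<^sup>2"] by (rule mult_right_mono[OF le]) simp
    qed (simp add: f_def)
    then show "\<exists>t0>0. \<forall>t w \<mu> d. \<bar>t\<bar> < t0 \<longrightarrow> w \<in> K \<longrightarrow> norm \<mu> \<le> R \<longrightarrow>
       c / 2 * (norm d)\<^sup>2 \<le> d \<bullet> (Jac g (Q t \<mu> w) *v (drift_quotient L t *v (transpose (Jac g (fst w)) *v d)))"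
      using t0(1) unfolding f_def prod.case by blast
  qed (use c(1) in simp)
qed

text \<open>Mean value theorem along the segment from \<open>\<mu>\<close> to \<open>\<nu>\<close>,
  which stays in the ball by convexity. It gives both the inward direction on a sphere and
  uniqueness of the zero.\<close>

lemma constraint_strongly_monotone:
  assumes lb: "\<And>\<mu> d. norm \<mu> \<le> R \<Longrightarrow>
      c * (norm d)\<^sup>2 \<le> d \<bullet> (Jac g (Q t \<mu> w) *v (drift_quotient L t *v (transpose (Jac g (fst w)) *v d)))"
    and \<mu>: "norm \<mu> \<le> R" and \<nu>: "norm \<nu> \<le> R"
  shows "(\<nu> - \<mu>) \<bullet> (g (Q t \<nu> w) - g (Q t \<mu> w)) \<le> - (t\<^sup>2 / 2) * c * (norm (\<nu> - \<mu>))\<^sup>2"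
proof -
  let ?d = "\<nu> - \<mu>"
  let ?D = "\<lambda>\<mu>. ?d \<bullet> (Jac g (Q t \<mu> w) *v (drift_quotient L t *v (transpose (Jac g (fst w)) *v ?d)))"
  have "((\<lambda>\<mu>. ?d \<bullet> g (Q t \<mu> w)) has_derivative (\<lambda>a. ?d \<bullet> (- (t\<^sup>2 / 2) *\<^sub>R
      (Jac g (Q t \<nu> w) *v (drift_quotient L t *v (transpose (Jac g (fst w)) *v a)))))) (at \<nu>)" for \<nu>
    by (rule has_derivative_inner_right[OF has_derivative_constraint_in_multiplier])
  from has_derivative_along_line[OF this]
  have "((\<lambda>s. ?d \<bullet> g (Q t (\<mu> + s *\<^sub>R ?d) w)) has_real_derivative - (t\<^sup>2 / 2) * ?D (\<mu> + s *\<^sub>R ?d)) (at s)" for s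
    by (simp only: inner_scaleR_right)
  from MVT2[of 0 1, OF zero_less_one this] obtain s where s: "0 < s" "s < 1"
    "?d \<bullet> g (Q t (\<mu> + 1 *\<^sub>R ?d) w) - ?d \<bullet> g (Q t (\<mu> + 0 *\<^sub>R ?d) w) = - (t\<^sup>2 / 2) * ?D (\<mu> + s *\<^sub>R ?d)"
    by auto
  have "\<mu> + s *\<^sub>R ?d = (1 - s) *\<^sub>R \<mu> + s *\<^sub>R \<nu>"
    by (simp add: algebra_simps)
  moreover have "(1 - s) *\<^sub>R \<mu> + s *\<^sub>R \<nu> \<in> cball 0 R"
    using s(1,2) \<mu> \<nu> by (intro convexD[OF convex_cball]) auto
  ultimately have "c * (norm ?d)\<^sup>2 \<le> ?D (\<mu> + s *\<^sub>R ?d)"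
    by (intro lb) simp
  then have "- (t\<^sup>2 / 2) * ?D (\<mu> + s *\<^sub>R ?d) \<le> - (t\<^sup>2 / 2) * (c * (norm ?d)\<^sup>2)"
    by (intro mult_left_mono_neg) auto
  with s(3) show ?thesis
    by (simp add: inner_diff_right mult.assoc)
qed

text \<open>The derivative of the residual in t starts at G(q) p = 0 and is itself
  \<open>C1\<close>, hence O(t) uniformly on \<open>K\<close>; one more mean value inequality gives
  O(t^2).\<close>

lemma unconstrained_residual_bound:
  assumes K: "compact K" "K \<subseteq> cotangent_bundle g"
  shows "\<exists>C>0. \<forall>w\<in>K. \<forall>t. \<bar>t\<bar> \<le> 1 \<longrightarrow> norm (g (Q t 0 w)) \<le> C * t\<^sup>2"
proof -
  define p where "p = (\<lambda>t w. snd w - (t / 2) *\<^sub>R grad U (fst w))"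
  define x where "x = (\<lambda>t w. fst w + drift L t *v p t w)"
  \<comment> \<open>\<open>x'\<close> is the time derivative of \<open>x\<close>, and
    \<open>\<psi>\<close> that of g along \<open>x\<close>.\<close>
  define x' where "x' = (\<lambda>t w. drift L t *v (- (1 / 2) *\<^sub>R grad U (fst w)) + rot L t *v p t w)"
  define \<psi> where "\<psi> = (\<lambda>y. Jac g (x (fst y) (snd y)) *v x' (fst y) (snd y))"
  have Q_eq: "Q t 0 w = x t w" for t w
    by (simp add: pre_step_eq Let_def x_def p_def)
  have C1_p: "C1 (\<lambda>y. p (fst y) (snd y))"
    unfolding p_def
    by (intro C1_diff C1_scaleR C1_linear_compose[OF bounded_linear_divide] C1_compose[OF C1_grad[OF U]] C1_fst C1_snd C1_id)
  have C1_x: "C1 (\<lambda>y. x (fst y) (snd y))"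
    unfolding x_def by (intro C1_add C1_matrix_vector C1_compose[OF C1_drift] C1_p C1_fst C1_snd C1_id)
  have "C1 \<psi>"
    unfolding \<psi>_def x'_def
    by (intro C1_add C1_matrix_vector C1_compose[OF C1_drift] C1_compose[OF C1_rot] C1_compose[OF C1_Jac[OF g]]
        C1_p C1_x C1_scaleR C1_const C1_compose[OF C1_grad[OF U]] C1_fst C1_snd C1_id)
  from C1_imp_deviation_bound[OF this K(1)]
  obtain C where C: "C > 0" "\<forall>w\<in>K. \<forall>t. \<bar>t\<bar> \<le> 1 \<longrightarrow> norm (\<psi> (t, w) - \<psi> (0, w)) \<le> C * \<bar>t\<bar>"
    by blast
  have \<psi>_0: "\<psi> (0, w) = 0" if "w \<in> K" for w
    using that K(2) by (auto simp: \<psi>_def x_def x'_def p_def drift_0 rot_0 cotangent_bundle_iff)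
  have bound: "norm (\<psi> (t, w)) \<le> C * \<bar>t\<bar>" if "w \<in> K" "\<bar>t\<bar> \<le> 1" for t w
    using C(2) \<psi>_0[OF that(1)] that by fastforce
  have deriv: "((\<lambda>t. g (x t w)) has_vector_derivative \<psi> (t, w)) (at t)" for t w
  proof -
    have "((\<lambda>t. p t w) has_vector_derivative - (1 / 2) *\<^sub>R grad U (fst w)) (at t)"
      unfolding p_def by (auto intro!: derivative_eq_intros simp: has_vector_derivative_def algebra_simps)
    from bounded_bilinear.has_vector_derivative[OF bounded_bilinear_matrix_vector has_vector_derivative_drift[of L] this]
    have "((\<lambda>t. x t w) has_vector_derivative x' t w) (at t)"
      unfolding x_def x'_def
      using has_vector_derivative_add[OF has_vector_derivative_const[of "fst w"]] by fastforce
    then have "((\<lambda>t. g (x t w)) has_derivative (\<lambda>h. Jac g (x t w) *v (h *\<^sub>R x' t w))) (at t)"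
      unfolding has_vector_derivative_def by (rule has_derivative_compose[OF _ has_derivative_Jac[OF g]])
    then show ?thesis
      by (simp add: has_vector_derivative_def \<psi>_def matrix_vector_mult_scaleR)
  qed
  have "norm (g (x t w)) \<le> C * t\<^sup>2" if w: "w \<in> K" and t: "\<bar>t\<bar> \<le> 1" for t w
  proof -
    have "norm (g (x t w) - g (x 0 w)) \<le> (C * \<bar>t\<bar>) * norm (t - 0)"
    proof (rule differentiable_bound[of "{-\<bar>t\<bar>..\<bar>t\<bar>}" "\<lambda>t. g (x t w)" "\<lambda>s h. h *\<^sub>R \<psi> (s, w)"])
      show "((\<lambda>t. g (x t w)) has_derivative (\<lambda>h. h *\<^sub>R \<psi> (s, w))) (at s within {-\<bar>t\<bar>..\<bar>t\<bar>})" for s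
        using deriv[of w s] unfolding has_vector_derivative_def by (rule has_derivative_at_withinI)
      fix s assume s: "s \<in> {-\<bar>t\<bar>..\<bar>t\<bar>}"
      have "norm (\<psi> (s, w)) \<le> C * \<bar>s\<bar>"
        using s t by (intro bound w) auto
      also have "\<dots> \<le> C * \<bar>t\<bar>"
        using s C(1) by (intro mult_left_mono) auto
      finally have le: "norm (\<psi> (s, w)) \<le> C * \<bar>t\<bar>" .
      show "onorm (\<lambda>h. h *\<^sub>R \<psi> (s, w)) \<le> C * \<bar>t\<bar>"
        by (rule onorm_le) (use mult_left_mono[OF le abs_ge_zero] in \<open>simp add: mult_ac\<close>)
    qed auto
    moreover have "g (x 0 w) = 0"
      using w K(2) by (auto simp: x_def drift_0 cotangent_bundle_iff)
    ultimately show ?thesis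
      by (simp add: power2_eq_square mult.assoc)
  qed
  then show ?thesis
    unfolding Q_eq using C(1) by blast
qed

text \<open>At t = 0 the defect is G(q) p = 0. Its order t compensates the factor 2/t in the
  equation for the second multiplier.\<close>

lemma velocity_constraint_bound:
  assumes K: "compact K" "K \<subseteq> cotangent_bundle g"
  shows "\<exists>C>0. \<forall>w\<in>K. \<forall>\<mu>. norm \<mu> \<le> R \<longrightarrow> (\<forall>t. \<bar>t\<bar> \<le> 1 \<longrightarrow>
    norm (Jac g (Q t \<mu> w) *v snd (pre_step g U L t \<mu> w)) \<le> C * \<bar>t\<bar>)"
proof -
  define f where "f = (\<lambda>y :: real \<times> (real^'k) \<times> (real^'m) \<times> (real^'m).
    Jac g (Q (fst y) (fst (snd y)) (snd (snd y))) *v snd (pre_step g U L (fst y) (fst (snd y)) (snd (snd y))))"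
  have "C1 (\<lambda>y :: real \<times> (real^'k) \<times> (real^'m) \<times> (real^'m). pre_step g U L (fst y) (fst (snd y)) (snd (snd y)))"
    by (intro C1_pre_step g U C1_fst C1_snd C1_id)
  then have "C1 f"
    unfolding f_def by (intro C1_matrix_vector C1_compose[OF C1_Jac[OF g]] C1_fst[where f = "\<lambda>y. pre_step g U L (fst y) (fst (snd y)) (snd (snd y))"]
       C1_snd[where f = "\<lambda>y. pre_step g U L (fst y) (fst (snd y)) (snd (snd y))"])
  from C1_imp_deviation_bound[OF this compact_Times[OF compact_cball[of 0 R] K(1)]]
  obtain C where C: "C > 0" "\<forall>y\<in>cball 0 R \<times> K. \<forall>t. \<bar>t\<bar> \<le> 1 \<longrightarrow> norm (f (t, y) - f (0, y)) \<le> C * \<bar>t\<bar>"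
    by blast
  show ?thesis
  proof (intro exI[of _ C] conjI ballI allI impI)
    fix w t and \<mu> :: "real^'k" assume w: "w \<in> K" and \<mu>: "norm \<mu> \<le> R" and t: "\<bar>t\<bar> \<le> (1::real)"
    have "f (0, (\<mu>, w)) = 0"
      using w K(2) by (auto simp: f_def pre_step_0 cotangent_bundle_iff)
    moreover have "norm (f (t, (\<mu>, w)) - f (0, (\<mu>, w))) \<le> C * \<bar>t\<bar>"
      using C(2) w \<mu> t by simp
    ultimately show "norm (Jac g (Q t \<mu> w) *v snd (pre_step g U L t \<mu> w)) \<le> C * \<bar>t\<bar>"
      by (simp add: f_def)
  qed (rule C(1))
qed

text \<open>At t = 0 a step is the identity for any multipliers, so bounded multipliers move a point
  by O(t). This confines new positions and whole orbits to compact sets.\<close>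

lemma step_with_displacement_bound:
  assumes K: "compact K"
  shows "\<exists>C>0. \<forall>w\<in>K. \<forall>m. norm (fst m) \<le> R \<and> norm (snd m) \<le> R \<longrightarrow> (\<forall>t. \<bar>t\<bar> \<le> 1 \<longrightarrow>
    dist (step_with g U L t m w) w \<le> C * \<bar>t\<bar>)"
proof -
  define f where "f = (\<lambda>y. step_with g U L (fst y) (fst (snd y)) (snd (snd y)))"
  have "C1 f"
    unfolding f_def by (intro C1_step_with g U C1_fst C1_snd C1_id)
  from C1_imp_deviation_bound[OF this compact_Times[OF compact_Times[OF compact_cball[of 0 R] compact_cball[of 0 R]] K]]
  obtain C where C: "C > 0" "\<forall>y\<in>(cball 0 R \<times> cball 0 R) \<times> K. \<forall>t. \<bar>t\<bar> \<le> 1 \<longrightarrow> norm (f (t, y) - f (0, y)) \<le> C * \<bar>t\<bar>"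
    by blast
  show ?thesis
  proof (intro exI[of _ C] conjI ballI allI impI)
    fix w and m :: "(real^'k) \<times> (real^'k)" and t assume w: "w \<in> K" and m: "norm (fst m) \<le> R \<and> norm (snd m) \<le> R" and t: "\<bar>t\<bar> \<le> (1::real)"
    have "norm (f (t, (m, w)) - f (0, (m, w))) \<le> C * \<bar>t\<bar>"
      using C(2)[rule_format, of "(m, w)" t] w m t by (simp add: mem_Times_iff)
    then show "dist (step_with g U L t m w) w \<le> C * \<bar>t\<bar>"
      by (simp add: f_def step_with_0 dist_norm)
  qed (rule C(1))
qed

text \<open>The condition is linear with matrix (t/2) G G^T, invertible at the new position. The
  displayed equation is kept for the later bound on the norm of the solution.\<close>

lemma second_multiplier_exists:
  assumes q: "g (fst y) = 0" and t: "t \<noteq> 0"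
  shows "\<exists>\<mu>'. constraint_kick g t \<mu>' y \<in> cotangent_bundle g \<and>
    (t / 2) *\<^sub>R (Jac g (fst y) *v (transpose (Jac g (fst y)) *v \<mu>')) = Jac g (fst y) *v snd y \<and>
    (\<forall>\<nu>. constraint_kick g t \<nu> y \<in> cotangent_bundle g \<longrightarrow> \<nu> = \<mu>')"
proof -
  let ?G = "Jac g (fst y)"
  let ?M = "\<lambda>\<mu>. ?G *v (transpose ?G *v \<mu>)"
  have lin: "linear ?M"
    using linear_compose[OF matrix_vector_mul_linear matrix_vector_mul_linear, of ?G "transpose ?G"] by (simp add: o_def del: transpose_matrix_vector)
  have inj: "d = 0" if "?M d = 0" for d
  proof -
    have "(transpose ?G *v d) \<bullet> (transpose ?G *v d) = 0"
      using inner_transpose_left[of ?G d "transpose ?G *v d"] that by (simp del: transpose_matrix_vector)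
    then show "d = 0"
      using transpose_full_rank_eq_0[OF full_rank[OF q]] by simp
  qed
  have in_iff: "constraint_kick g t \<nu> y \<in> cotangent_bundle g \<longleftrightarrow> (t / 2) *\<^sub>R ?M \<nu> = ?G *v snd y" for \<nu>
    using q by (auto simp: cotangent_bundle_iff constraint_kick_eq matrix_vector_mult_diff_distrib matrix_vector_mult_scaleR
        simp del: transpose_matrix_vector)
  have "surj ?M"
    by (rule linear_injective_imp_surjective[OF lin _ refl])
      (use inj in \<open>simp add: linear_injective_0[OF lin] del: transpose_matrix_vector\<close>)
  then obtain \<mu>' where \<mu>': "?M \<mu>' = (2 / t) *\<^sub>R (?G *v snd y)"
    unfolding surj_def by metis
  then have eq: "(t / 2) *\<^sub>R ?M \<mu>' = ?G *v snd y"
    using t by simp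
  have "\<nu> = \<mu>'" if "constraint_kick g t \<nu> y \<in> cotangent_bundle g" for \<nu>
  proof -
    have "(t / 2) *\<^sub>R ?M \<nu> = (t / 2) *\<^sub>R ?M \<mu>'"
      using that in_iff eq by simp
    then have "?M \<nu> = ?M \<mu>'"
      using t by simp
    then have "?M (\<nu> - \<mu>') = 0"
      by (simp add: linear_diff[OF lin] del: transpose_matrix_vector)
    then show ?thesis
      using inj[of "\<nu> - \<mu>'"] by simp
  qed
  with eq in_iff[of \<mu>'] show ?thesis
    by blast
qed

lemma regular_multiplier_if_lower_bound:
  assumes t: "t \<noteq> 0" and c: "0 < c"
    and lb: "\<And>d. c * (norm d)\<^sup>2 \<le>
      d \<bullet> (Jac g (Q t (fst m) w) *v (drift_quotient L t *v (transpose (Jac g (fst w)) *v d)))"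
  shows "regular_multiplier g U L t w m"
proof -
  define D where "D = (\<lambda>d. - (t\<^sup>2 / 2) *\<^sub>R
      (Jac g (Q t (fst m) w) *v (drift_quotient L t *v (transpose (Jac g (fst w)) *v d))))"
  have D: "((\<lambda>\<mu>. g (Q t \<mu> w)) has_derivative D) (at (fst m))"
    unfolding D_def by (rule has_derivative_constraint_in_multiplier)
  have lin: "linear D"
    using D has_derivative_linear by blast
  have "d = 0" if "D d = 0" for d
  proof -
    have "Jac g (Q t (fst m) w) *v (drift_quotient L t *v (transpose (Jac g (fst w)) *v d)) = 0"
      using that t by (simp add: D_def del: transpose_matrix_vector)
    then have "c * (norm d)\<^sup>2 \<le> 0"
      using lb[of d] by simp
    then show ?thesis
      using c by (simp add: mult_le_0_iff)
  qed
  then have "inj D"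
    by (simp add: linear_injective_0[OF lin])
  then have "inj ((*v) (matrix D))"
    by (simp add: matrix_vector_mul(2)[OF lin])
  then have "invertible (matrix D)"
    using matrix_left_invertible_injective invertible_left_inverse by blast
  then show ?thesis
    by (simp add: regular_multiplier_def fst_step_with jacobian_def frechet_derivative_at[OF D, symmetric])
qed

text \<open>Existence is shown with radii \<open>r1\<close> and \<open>r2\<close> that depend on
  \<open>K\<close> only, uniqueness in any larger ball of radius \<open>R\<close>. Only the
  threshold \<open>t0\<close> depends on \<open>R\<close>: a larger ball could contain a second,
  distant solution unless t is smaller.\<close>

lemma multipliers_unique_and_regular:
  assumes K: "compact K" "K \<subseteq> cotangent_bundle g"
  shows "\<exists>r>0. \<forall>R\<ge>r. \<exists>t0>0. \<forall>t w. 0 < \<bar>t\<bar> \<longrightarrow> \<bar>t\<bar> < t0 \<longrightarrow> w \<in> K \<longrightarrow>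
    (\<exists>!m. is_multiplier g U L (ball 0 R) t w m) \<and>
    (\<forall>m. is_multiplier g U L (ball 0 R) t w m \<longrightarrow> regular_multiplier g U L t w m)"
\<comment> \<open>\<open>infdist\<close> to the empty set is 0, so a thickening of the empty set
  would be the whole space and not compact.\<close>
proof (cases "K = {}")
  case True
  then show ?thesis by (auto intro!: exI[of _ "1::real"])
next
  case False
  have M: "g (fst w) = 0" if "w \<in> K" for w
    using that K(2) by (auto simp: cotangent_bundle_iff)
  from constraint_derivative_lower_bound[OF K(1) M]
  obtain c where c: "c > 0" and lb: "\<forall>R. \<exists>t0>0. \<forall>t w \<mu> d. \<bar>t\<bar> < t0 \<longrightarrow> w \<in> K \<longrightarrow> norm \<mu> \<le> R \<longrightarrow>
    c * (norm d)\<^sup>2 \<le> d \<bullet> (Jac g (Q t \<mu> w) *v (drift_quotient L t *v (transpose (Jac g (fst w)) *v d)))"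
    by blast
  obtain C where C: "C > 0" "\<forall>w\<in>K. \<forall>t. \<bar>t\<bar> \<le> 1 \<longrightarrow> norm (g (Q t 0 w)) \<le> C * t\<^sup>2"
    using unconstrained_residual_bound[OF K] by blast
  \<comment> \<open>On the sphere of radius \<open>r1\<close>, monotonicity contributes
    \<open>- (t\<^sup>2 / 2) * c * r1\<^sup>2\<close> and the residual at most
    \<open>r1 * C * t\<^sup>2\<close>. The field points inward as soon as
    \<open>C \<le> c * r1 / 2\<close>.\<close>
  define r1 where "r1 = 2 * C / c + 1"
  have r1: "r1 > 0" "C \<le> c * r1 / 2"
    using C(1) c by (simp_all add: r1_def field_simps add_pos_pos)
  obtain Cv where Cv: "Cv > 0" "\<forall>w\<in>K. \<forall>\<mu>. norm \<mu> \<le> r1 \<longrightarrow> (\<forall>t. \<bar>t\<bar> \<le> 1 \<longrightarrow>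
      norm (Jac g (Q t \<mu> w) *v snd (pre_step g U L t \<mu> w)) \<le> Cv * \<bar>t\<bar>)"
    using velocity_constraint_bound[OF K, of r1] by (elim exE conjE) (rule that)
  obtain Cd where Cd: "Cd > 0" "\<forall>w\<in>K. \<forall>m :: (real^'k) \<times> (real^'k). norm (fst m) \<le> r1 \<and> norm (snd m) \<le> r1 \<longrightarrow> (\<forall>t. \<bar>t\<bar> \<le> 1 \<longrightarrow>
      dist (step_with g U L t m w) w \<le> Cd * \<bar>t\<bar>)"
    using step_with_displacement_bound[OF K(1), of r1] by (elim exE conjE) (rule that)
  define K2 where "K2 = {q. g q = 0} \<inter> {q. infdist q (fst ` K) \<le> 1}"
  have "closed {q. g q = 0}"
    by (rule closed_Collect_eq[OF C1_continuous_on[OF C1_if_times_diff_2[OF g]] continuous_on_const])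
  moreover have "compact {q. infdist q (fst ` K) \<le> 1}"
    using False by (intro compact_infdist_le compact_continuous_image continuous_on_fst continuous_on_id K(1)) auto
  ultimately have "compact K2"
    unfolding K2_def by (rule closed_Int_compact)
  then have "\<exists>c>0. \<forall>q\<in>K2. \<forall>d. c * (norm d)\<^sup>2 \<le> (norm (transpose (Jac g q) *v d))\<^sup>2"
    by (rule transpose_Jac_lower_bound) (simp add: K2_def)
  then obtain c2 where c2: "c2 > 0" "\<forall>q\<in>K2. \<forall>d. c2 * (norm d)\<^sup>2 \<le> (norm (transpose (Jac g q) *v d))\<^sup>2"
    by (elim exE conjE) (rule that)
  \<comment> \<open>Pairing the linear equation for \<open>\<mu>'\<close> with \<open>\<mu>'\<close>
    bounds \<open>c2 * (norm \<mu>')\<^sup>2\<close> by (2/|t|) times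
    \<open>norm \<mu>' * Cv * \<bar>t\<bar>\<close>.\<close>
  define r2 where "r2 = 2 * Cv / c2"
  show ?thesis
  \<comment> \<open>The solutions have norm at most \<open>max r1 r2\<close>; the margin 1 places
    them inside the open ball.\<close>
  proof (rule exI[of _ "max r1 r2 + 1"], intro conjI allI impI)
    show "0 < max r1 r2 + 1"
      using r1(1) by simp
    fix R assume R: "max r1 r2 + 1 \<le> R"
    obtain t1 where t1: "t1 > 0" "\<forall>t w \<mu> d. \<bar>t\<bar> < t1 \<longrightarrow> w \<in> K \<longrightarrow> norm \<mu> \<le> R \<longrightarrow>
      c * (norm d)\<^sup>2 \<le> d \<bullet> (Jac g (Q t \<mu> w) *v (drift_quotient L t *v (transpose (Jac g (fst w)) *v d)))"
      using lb by blast
    show "\<exists>t0>0. \<forall>t w. 0 < \<bar>t\<bar> \<longrightarrow> \<bar>t\<bar> < t0 \<longrightarrow> w \<in> K \<longrightarrow>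
      (\<exists>!m. is_multiplier g U L (ball 0 R) t w m) \<and>
      (\<forall>m. is_multiplier g U L (ball 0 R) t w m \<longrightarrow> regular_multiplier g U L t w m)"
    proof (rule exI[of _ "min t1 (min 1 (1 / Cd))"], intro conjI allI impI)
      show "0 < min t1 (min 1 (1 / Cd))"
        using t1(1) Cd(1) by simp
    next
      fix t w assume "0 < \<bar>t\<bar>" and small: "\<bar>t\<bar> < min t1 (min 1 (1 / Cd))" and w: "w \<in> K"
      have t: "t \<noteq> 0" "\<bar>t\<bar> < t1" "\<bar>t\<bar> \<le> 1" "Cd * \<bar>t\<bar> \<le> 1"
        using \<open>0 < \<bar>t\<bar>\<close> small Cd(1) by (auto simp: field_simps)
      have lbR: "c * (norm d)\<^sup>2 \<le> d \<bullet> (Jac g (Q t \<mu> w) *v (drift_quotient L t *v (transpose (Jac g (fst w)) *v d)))"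
        if "norm \<mu> \<le> R" for \<mu> d
        using t1(2) t(2) w that by blast
      note mono = constraint_strongly_monotone[of R c t w, OF lbR]
      have inward: "\<mu> \<bullet> g (Q t \<mu> w) \<le> 0" if \<mu>: "norm \<mu> = r1" for \<mu>
      proof -
        have "\<mu> \<bullet> g (Q t \<mu> w) - \<mu> \<bullet> g (Q t 0 w) \<le> - (t\<^sup>2 / 2) * c * r1\<^sup>2"
          using mono[of 0 \<mu>] \<mu> R r1(1) by (simp add: inner_diff_right)
        moreover have "\<mu> \<bullet> g (Q t 0 w) \<le> r1 * (C * t\<^sup>2)"
        proof -
          have "\<mu> \<bullet> g (Q t 0 w) \<le> norm \<mu> * norm (g (Q t 0 w))"
            by (rule norm_cauchy_schwarz)
          also have "\<dots> \<le> r1 * (C * t\<^sup>2)"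
            using C(2) w t(3) r1(1) unfolding \<mu> by (intro mult_left_mono) auto
          finally show ?thesis .
        qed
        moreover have "r1 * t\<^sup>2 * C \<le> r1 * t\<^sup>2 * (c * r1 / 2)"
          using r1 by (intro mult_left_mono) auto
        ultimately show ?thesis
          by (simp add: power2_eq_square algebra_simps)
      qed
      have "continuous_on (cball 0 r1) (\<lambda>\<mu>. g (Q t \<mu> w))"
        using has_derivative_continuous[OF has_derivative_constraint_in_multiplier]
        by (intro continuous_at_imp_continuous_on) blast
      then obtain \<mu> where \<mu>: "\<mu> \<in> cball 0 r1" "g (Q t \<mu> w) = 0"
        using vector_field_has_zero[OF r1(1) _ inward] by blast
      define y where "y = pre_step g U L t \<mu> w"
      let ?G = "Jac g (fst y)"
      have gy: "g (fst y) = 0"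
        using \<mu>(2) by (simp add: y_def)
      obtain \<mu>' where \<mu>': "constraint_kick g t \<mu>' y \<in> cotangent_bundle g"
        "(t / 2) *\<^sub>R (?G *v (transpose ?G *v \<mu>')) = ?G *v snd y"
        "\<forall>\<nu>. constraint_kick g t \<nu> y \<in> cotangent_bundle g \<longrightarrow> \<nu> = \<mu>'"
        using second_multiplier_exists[OF gy t(1)] by blast
      have "norm \<mu>' \<le> r2"
      proof -
        have "dist (fst y) (fst w) \<le> dist (step_with g U L t (\<mu>, 0) w) w"
          using dist_fst_le[of "step_with g U L t (\<mu>, 0) w" w] by (simp add: fst_step_with y_def)
        also have "\<dots> \<le> 1"
          using Cd(2)[rule_format, OF w, of "(\<mu>, 0)" t] \<mu>(1) r1(1) t(3,4) by simp
        finally have "fst y \<in> K2"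
          using infdist_le[of "fst w" "fst ` K" "fst y"] w gy by (simp add: K2_def)
        then have "c2 * (norm \<mu>')\<^sup>2 \<le> (norm (transpose ?G *v \<mu>'))\<^sup>2"
          using c2(2) by blast
        also have "\<dots> = \<mu>' \<bullet> (?G *v (transpose ?G *v \<mu>'))"
          by (simp only: power2_norm_eq_inner inner_transpose_left)
        also have "\<dots> = (2 / t) * (\<mu>' \<bullet> (?G *v snd y))"
          using t(1) by (simp add: \<mu>'(2)[symmetric] del: transpose_matrix_vector)
        also have "\<dots> \<le> \<bar>2 / t\<bar> * \<bar>\<mu>' \<bullet> (?G *v snd y)\<bar>"
          by (metis abs_ge_self abs_mult)
        also have "\<dots> \<le> \<bar>2 / t\<bar> * (norm \<mu>' * norm (?G *v snd y))"
          by (intro mult_left_mono Cauchy_Schwarz_ineq2) simp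
        also have "\<dots> \<le> \<bar>2 / t\<bar> * (norm \<mu>' * (Cv * \<bar>t\<bar>))"
          using Cv(2) w \<mu>(1) t(3) unfolding y_def by (intro mult_left_mono) auto
        also have "\<dots> = norm \<mu>' * (2 * Cv)"
          using t(1) by simp
        finally have "norm \<mu>' * (norm \<mu>' * c2) \<le> norm \<mu>' * (2 * Cv)"
          by (simp add: power2_eq_square mult_ac)
        then have "norm \<mu>' = 0 \<or> norm \<mu>' * c2 \<le> 2 * Cv"
          by (metis mult_left_le_imp_le norm_ge_zero order_le_less)
        then show ?thesis
          using c2(1) Cv(1) by (auto simp: r2_def field_simps)
      qed
      then have m: "is_multiplier g U L (ball 0 R) t w (\<mu>, \<mu>')"
        using \<mu>(1) R \<mu>'(1) by (auto simp: is_multiplier_def step_with_eq y_def)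
      have unique: "n = (\<mu>, \<mu>')" if n: "is_multiplier g U L (ball 0 R) t w n" for n
      proof -
        have n': "norm (fst n) < R" "step_with g U L t n w \<in> cotangent_bundle g"
          using n by (auto simp: is_multiplier_def mem_Times_iff)
        then have "g (Q t (fst n) w) = 0"
          by (simp add: cotangent_bundle_iff fst_step_with)
        then have "0 \<le> - (t\<^sup>2 / 2) * c * (norm (fst n - \<mu>))\<^sup>2"
          using mono[of \<mu> "fst n"] \<mu> n'(1) R by simp
        then have "(t\<^sup>2 / 2 * c) * (norm (fst n - \<mu>))\<^sup>2 \<le> 0"
          by (simp only: mult_minus_left neg_0_le_iff_le)
        moreover have "0 < t\<^sup>2 / 2 * c"
          using t(1) c by simp
        ultimately have "(norm (fst n - \<mu>))\<^sup>2 \<le> 0"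
          using mult_pos_pos not_le by blast
        then have "fst n = \<mu>"
          by simp
        then show ?thesis
          using \<mu>'(3) n'(2) by (simp add: step_with_eq y_def prod_eq_iff)
      qed
      show "\<exists>!m. is_multiplier g U L (ball 0 R) t w m"
        using m unique by blast
      show "regular_multiplier g U L t w n" if "is_multiplier g U L (ball 0 R) t w n" for n
        using that
        by (intro regular_multiplier_if_lower_bound[OF t(1) c] lbR) (auto simp: is_multiplier_def mem_Times_iff)
    qed
  qed
qed

text \<open>The thresholds depend on a compact set of initial values, so the whole orbit must be
  confined to one fixed in advance. Induction on the steps does this: as long as the orbit is in it,
  the multipliers are bounded and the next displacement is O(\<epsilon>).\<close>

lemma compact_subset_integrator_domain:
  assumes K: "compact K" "K \<subseteq> cotangent_bundle g"
  shows "\<exists>r. \<forall>R\<ge>r. \<exists>\<epsilon>\<^sub>0>0. \<forall>\<epsilon>. 0 < \<bar>\<epsilon>\<bar> \<and> \<bar>\<epsilon>\<bar> < \<epsilon>\<^sub>0 \<longrightarrow> K \<subseteq> integrator_domain g U L (ball 0 R) \<epsilon> N"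
proof (cases "K = {}")
  case True
  then show ?thesis by (auto intro: exI[of _ "1::real"])
next
  case False
  let ?S = "cotangent_bundle g"
  \<comment> \<open>Orbits will stay within 1 of \<open>K\<close>. The second unit is there because
    \<open>small_enough_at\<close> asks for uniqueness on a neighbourhood of each orbit point, taken
    as a unit ball.\<close>
  define K2 where "K2 = ?S \<inter> {w. infdist w K \<le> 2}"
  have K2: "compact K2" "K2 \<subseteq> ?S"
    unfolding K2_def
    by (intro closed_Int_compact closed_cotangent_bundle g compact_infdist_le False K(1)) auto
  obtain r where r: "\<forall>R\<ge>r. \<exists>t0>0. \<forall>t w. 0 < \<bar>t\<bar> \<longrightarrow> \<bar>t\<bar> < t0 \<longrightarrow> w \<in> K2 \<longrightarrow>
    (\<exists>!m. is_multiplier g U L (ball 0 R) t w m) \<and>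
    (\<forall>m. is_multiplier g U L (ball 0 R) t w m \<longrightarrow> regular_multiplier g U L t w m)"
    using multipliers_unique_and_regular[OF K2] by (elim exE conjE) (rule that)
  show ?thesis
  proof (rule exI[of _ r], intro allI impI)
    fix R assume "r \<le> R"
    obtain t0 where t0: "t0 > 0" "\<forall>t w. 0 < \<bar>t\<bar> \<longrightarrow> \<bar>t\<bar> < t0 \<longrightarrow> w \<in> K2 \<longrightarrow>
      (\<exists>!m. is_multiplier g U L (ball 0 R) t w m) \<and>
      (\<forall>m. is_multiplier g U L (ball 0 R) t w m \<longrightarrow> regular_multiplier g U L t w m)"
      using r[THEN spec, THEN mp, OF \<open>r \<le> R\<close>] by (elim exE conjE) (rule that)
    obtain C where C: "C > 0" "\<forall>w\<in>K2. \<forall>m :: (real^'k) \<times> (real^'k). norm (fst m) \<le> R \<and> norm (snd m) \<le> R \<longrightarrow>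
      (\<forall>t. \<bar>t\<bar> \<le> 1 \<longrightarrow> dist (step_with g U L t m w) w \<le> C * \<bar>t\<bar>)"
      using step_with_displacement_bound[OF K2(1), of R] by (elim exE conjE) (rule that)
    \<comment> \<open>The last bound limits the total displacement in N steps to 1; N + 1 avoids
      division by zero when N = 0.\<close>
    define \<epsilon>\<^sub>0 where "\<epsilon>\<^sub>0 = min t0 (min 1 (1 / (C * (real N + 1))))"
    have pos: "C * (real N + 1) > 0"
      using C(1) by simp
    then have "\<epsilon>\<^sub>0 > 0"
      using t0(1) by (simp add: \<epsilon>\<^sub>0_def)
    moreover have "K \<subseteq> integrator_domain g U L (ball 0 R) \<epsilon> N" if \<epsilon>: "0 < \<bar>\<epsilon>\<bar>" "\<bar>\<epsilon>\<bar> < \<epsilon>\<^sub>0" for \<epsilon>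
    proof
      fix z assume z: "z \<in> K"
      have small: "\<bar>\<epsilon>\<bar> < t0" "\<bar>\<epsilon>\<bar> \<le> 1" "C * (real N + 1) * \<bar>\<epsilon>\<bar> \<le> 1"
        using \<epsilon>(2) pos by (auto simp: \<epsilon>\<^sub>0_def field_simps)
      have mult: "(\<exists>!m. is_multiplier g U L (ball 0 R) e w m)"
        "is_multiplier g U L (ball 0 R) e w m \<Longrightarrow> regular_multiplier g U L e w m"
        if "w \<in> K2" "\<bar>e\<bar> = \<bar>\<epsilon>\<bar>" for e w m
        using t0(2)[rule_format, of e w] that \<epsilon>(1) small(1) by auto
      let ?z = "\<lambda>n. integrator g U L (ball 0 R) \<epsilon> n z"
      have near: "infdist w K \<le> 1" if "n \<le> N" "dist w z \<le> real n * (C * \<bar>\<epsilon>\<bar>)" for n w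
      proof -
        have "infdist w K \<le> dist w z"
          by (rule infdist_le[OF z])
        also have "\<dots> \<le> (real N + 1) * (C * \<bar>\<epsilon>\<bar>)"
          using that C(1) by (elim order_trans) (intro mult_right_mono, auto)
        also have "\<dots> \<le> 1"
          using small(3) by (simp add: mult_ac)
        finally show ?thesis .
      qed
      have orbit: "n \<le> N \<Longrightarrow> ?z n \<in> ?S \<and> dist (?z n) z \<le> real n * (C * \<bar>\<epsilon>\<bar>)" for n
      proof (induction n)
        case 0
        then show ?case
          using z K(2) by (auto simp: integrator_def)
      next
        case (Suc n)
        then have IH: "?z n \<in> ?S" "dist (?z n) z \<le> real n * (C * \<bar>\<epsilon>\<bar>)"
          by auto
        then have zn: "?z n \<in> K2"
          using near[of n "?z n"] Suc.prems by (simp add: K2_def)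
        have m: "is_multiplier g U L (ball 0 R) \<epsilon> (?z n) (multipliers g U L (ball 0 R) \<epsilon> (?z n))"
          using mult(1)[OF zn] by (rule is_multiplier_multipliers) simp
        have step: "?z (Suc n) = step_with g U L \<epsilon> (multipliers g U L (ball 0 R) \<epsilon> (?z n)) (?z n)"
          by (simp add: integrator_def one_step_def)
        have "dist (?z (Suc n)) (?z n) \<le> C * \<bar>\<epsilon>\<bar>"
          unfolding step using m small(2)
          by (intro C(2)[rule_format, OF zn]) (auto simp: is_multiplier_def mem_Times_iff)
        then have "dist (?z (Suc n)) z \<le> real (Suc n) * (C * \<bar>\<epsilon>\<bar>)"
          using dist_triangle[of "?z (Suc n)" z "?z n"] IH(2) by (simp add: distrib_right)
        moreover have "?z (Suc n) \<in> ?S"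
          using m unfolding step is_multiplier_def by blast
        ultimately show ?case by blast
      qed
      have "small_enough_at g U L (ball 0 R) \<epsilon> (?z n)" if n: "n \<le> N" for n
        unfolding small_enough_at_def
      proof (intro ballI conjI)
        fix e assume "e \<in> {\<epsilon>, - \<epsilon>}"
        then have e: "\<bar>e\<bar> = \<bar>\<epsilon>\<bar>" by auto
        have zn: "?z n \<in> ?S" "infdist (?z n) K \<le> 1"
          using orbit[OF n] near[OF n] by auto
        have "\<forall>\<^sub>F w in nhds (?z n). w \<in> ball (?z n) 1"
          by (rule eventually_nhds_in_open) auto
        then show "\<forall>\<^sub>F w in nhds (?z n). w \<in> ?S \<longrightarrow> (\<exists>!m. is_multiplier g U L (ball 0 R) e w m)"
        proof eventually_elim
          case (elim w)
          then have "w \<in> ?S \<Longrightarrow> w \<in> K2"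
            using infdist_triangle[of w K "?z n"] zn(2) by (simp add: K2_def dist_commute)
          then show ?case
            using mult(1)[OF _ e] by blast
        qed
        have "?z n \<in> K2"
          using zn by (simp add: K2_def)
        then show "regular_multiplier g U L e (?z n) (multipliers g U L (ball 0 R) e (?z n))"
          by (intro mult(2)[OF _ e] is_multiplier_multipliers mult(1)[OF _ e])
      qed
      then show "z \<in> integrator_domain g U L (ball 0 R) \<epsilon> N"
        using z K(2) by (auto simp: integrator_domain_def)
    qed
    ultimately show "\<exists>\<epsilon>\<^sub>0>0. \<forall>\<epsilon>. 0 < \<bar>\<epsilon>\<bar> \<and> \<bar>\<epsilon>\<bar> < \<epsilon>\<^sub>0 \<longrightarrow> K \<subseteq> integrator_domain g U L (ball 0 R) \<epsilon> N"
      by blast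
  qed
qed

end

text \<open>The third conjunct guards the first two, which speak only of
  \<open>integrator_domain\<close>, against being vacuous: every compact part of the bundle lies in
  that domain for each sufficiently large ball and all sufficiently small nonzero step sizes of
  either sign.\<close>

theorem theorem3:
  fixes g :: "real^'m \<Rightarrow> real^'k" and U :: "real^'m \<Rightarrow> real" and L :: "real^'m^'m"
  assumes "smooth_map g" and "smooth_map U"
    and "\<And>q. g q = 0 \<Longrightarrow> rank (Jac g q) = CARD('k)"
    and "transpose L = - L"
  shows
    "(\<forall>B \<epsilon> N. open B \<longrightarrow>
       (\<forall>z \<in> integrator_domain g U L B \<epsilon> N.
          integrator g U L B \<epsilon> N z \<in> cotangent_bundle g \<and>
          integrator g U L B \<epsilon> N differentiable (at z within cotangent_bundle g) \<and>
          (\<forall>u \<in> tangent_space (cotangent_bundle g) z. \<forall>v \<in> tangent_space (cotangent_bundle g) z.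
             pullback_on (cotangent_bundle g) (integrator g U L B \<epsilon> N) (Omega_mag L) z u v
               = Omega_mag L u v)) \<and>
       (\<forall>z \<in> integrator_domain g U L B (- \<epsilon>) N.
          integrator g U L B \<epsilon> N (integrator g U L B (- \<epsilon>) N z) = z)) \<and>
     (\<forall>K N. compact K \<and> K \<subseteq> cotangent_bundle g \<longrightarrow>
       (\<exists>r. \<forall>R\<ge>r. \<exists>\<epsilon>\<^sub>0>0. \<forall>\<epsilon>. 0 < \<bar>\<epsilon>\<bar> \<and> \<bar>\<epsilon>\<bar> < \<epsilon>\<^sub>0 \<longrightarrow>
          K \<subseteq> integrator_domain g U L (ball 0 R) \<epsilon> N))"
proof -
  have g: "times_diff (Suc (Suc 0)) g" and U: "times_diff (Suc (Suc 0)) U"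
    using assms(1,2) by (simp_all only: smooth_map_def)
  show ?thesis
  proof (intro conjI allI impI ballI)
    fix B :: "(real^'k) set" and \<epsilon> N z
    assume B: "open B" and "z \<in> integrator_domain g U L B \<epsilon> N"
    then have z: "z \<in> cotangent_bundle g" "\<forall>n\<le>N. small_enough_at g U L B \<epsilon> (integrator g U L B \<epsilon> n z)"
      by (auto simp: integrator_domain_def)
    note * = integrator_preserves_form[OF g U assms(3,4) B z]
    show "integrator g U L B \<epsilon> N z \<in> cotangent_bundle g"
      using * by blast
    show "integrator g U L B \<epsilon> N differentiable (at z within cotangent_bundle g)"
      using * preserves_form_at_imp_pullback(1) by blast
    show "pullback_on (cotangent_bundle g) (integrator g U L B \<epsilon> N) (Omega_mag L) z u v = Omega_mag L u v"
      if "u \<in> tangent_space (cotangent_bundle g) z" "v \<in> tangent_space (cotangent_bundle g) z" for u v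
      using * that preserves_form_at_imp_pullback(2) by blast
  next
    fix B :: "(real^'k) set" and \<epsilon> N z
    assume "z \<in> integrator_domain g U L B (- \<epsilon>) N"
    then have "z \<in> cotangent_bundle g" "\<forall>n\<le>N. small_enough_at g U L B (- \<epsilon>) (integrator g U L B (- \<epsilon>) n z)"
      by (auto simp: integrator_domain_def)
    then show "integrator g U L B \<epsilon> N (integrator g U L B (- \<epsilon>) N z) = z"
      using integrator_inverse[OF g U assms(3,4)] by blast
  next
    fix K :: "((real^'m) \<times> (real^'m)) set" and N
    assume "compact K \<and> K \<subseteq> cotangent_bundle g"
    then show "\<exists>r. \<forall>R\<ge>r. \<exists>\<epsilon>\<^sub>0>0. \<forall>\<epsilon>. 0 < \<bar>\<epsilon>\<bar> \<and> \<bar>\<epsilon>\<bar> < \<epsilon>\<^sub>0 \<longrightarrow>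
        K \<subseteq> integrator_domain g U L (ball 0 R) \<epsilon> N"
      using compact_subset_integrator_domain[OF g U assms(3)] by blast
  qed
qed

end
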